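(* Let $E\to M$ be a vector bundle with a nondegenerate symmetric bilinear form $\langle\cdot,\cdot\rangle$ and a bundle map $\rho:E\to TM$, and let $\mathcal D:C^\infty(M)\to\Gamma(E)$ be defined by $\langle\mathcal Df,e\rangle=\rho(e)f$. (a) Let $(E,\langle\cdot,\cdot\rangle,[\cdot,\cdot],\rho)$ be a Courant algebroid in the sense of Definition A (see context), and let $\circ$ be the operation on $\Gamma(E)$ given by $e_1\circ e_2=[e_1,e_2]+\frac12\mathcal D\langle e_1,e_2\rangle$. Then $(E,\langle\cdot,\cdot\rangle,\circ,\rho)$ is a Courant algebroid in the sense of Definition B (see context). (b) Conversely, let $(E,\langle\cdot,\cdot\rangle,\circ,\rho)$ be a Courant algebroid in the sense of Definition B, and let $[e_1,e_2]=\frac12(e_1\circ e_2-e_2\circ e_1)$ be the skew-symmetrization of $\circ$. Then $(E,\langle\cdot,\cdot\rangle,[\cdot,\cdot],\rho)$ is a Courant algebroid in the sense of Definition A.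
   Context: Manifolds are smooth and real. Definition A. A Courant algebroid is a vector bundle $E\to M$ with a nondegenerate symmetric bilinear form $\langle\cdot,\cdot\rangle$ on the bundle, a skew-symmetric $\mathbb R$-bilinear bracket $[\cdot,\cdot]$ on $\Gamma(E)$ and a bundle map $\rho:E\to TM$ such that, with $\mathcal D$ defined by $\langle\mathcal Df,e\rangle=\rho(e)f$, $J(e_1,e_2,e_3)=[[e_1,e_2],e_3]+[[e_2,e_3],e_1]+[[e_3,e_1],e_2]$, and $T(e_1,e_2,e_3)=\frac16\big(\langle[e_1,e_2],e_3\rangle+\langle[e_2,e_3],e_1\rangle+\langle[e_3,e_1],e_2\rangle\big)$, for all sections and all $f,g\in C^\infty(M)$: 1. $J(e_1,e_2,e_3)=\mathcal D T(e_1,e_2,e_3)$; 2. $\rho[e_1,e_2]=[\rho e_1,\rho e_2]$; 3. $[e_1,fe_2]=f[e_1,e_2]+(\rho(e_1)f)e_2-\frac12\langle e_1,e_2\rangle\mathcal Df$; 4. $\rho\circ\mathcal D=0$, i.e. $\langle\mathcal Df,\mathcal Dg\rangle=0$; 5. $\rho(e)\langle h_1,h_2\rangle=\langle[e,h_1]+\frac12\mathcal D\langle e,h_1\rangle,h_2\rangle+\langle h_1,[e,h_2]+\frac12\mathcal D\langle e,h_2\rangle\rangle$. Definition B. A Courant algebroid is a vector bundle $E\to M$ with a nondegenerate symmetric bilinear form $\langle\cdot,\cdot\rangle$ on the bundle, an $\mathbb R$-bilinear operation $\circ$ on $\Gamma(E)$ and a bundle map $\rho:E\to TM$ such that, with the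 same $\mathcal D$, for all sections and all $f\in C^\infty(M)$: 1. $e_1\circ(e_2\circ e_3)=(e_1\circ e_2)\circ e_3+e_2\circ(e_1\circ e_3)$; 2. $\rho(e_1\circ e_2)=[\rho(e_1),\rho(e_2)]$; 3. $e_1\circ fe_2=f(e_1\circ e_2)+(\rho(e_1)f)e_2$; 4. $e\circ e=\frac12\mathcal D\langle e,e\rangle$; 5. $\rho(e)\langle h_1,h_2\rangle=\langle e\circ h_1,h_2\rangle+\langle h_1,e\circ h_2\rangle$. *)

theory Defs
  imports "HOL-Analysis.Analysis"
begin

section \<open>Smooth maps between normed spaces\<close>

text \<open>Intended for open \<open>S\<close>: the iterated directional derivatives of \<open>f\<close> up to order \<open>n\<close>
  exist, are Frechet differentiable below order \<open>n\<close>, and are continuous.\<close>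

primrec differentiable_upto ::
    "nat \<Rightarrow> 'a::real_normed_vector set \<Rightarrow> ('a \<Rightarrow> 'c::real_normed_vector) \<Rightarrow> bool" where
  "differentiable_upto 0 S f \<longleftrightarrow> continuous_on S f"
| "differentiable_upto (Suc n) S f \<longleftrightarrow>
     (\<forall>x\<in>S. f differentiable (at x)) \<and>
     (\<forall>v. differentiable_upto n S (\<lambda>x. frechet_derivative f (at x) v))"

definition smooth_on :: "'a::real_normed_vector set \<Rightarrow> ('a \<Rightarrow> 'c::real_normed_vector) \<Rightarrow> bool" where
  "smooth_on S f \<longleftrightarrow> (\<forall>n. differentiable_upto n S f)"


section \<open>Smooth manifolds\<close>

text \<open>The manifold is the whole type \<open>'m\<close>. A chart is a pair \<open>(U, \<phi>)\<close>; only the values of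
  \<open>\<phi>\<close> on \<open>U\<close> matter. The model space is a finite-dimensional inner product space rather than
  an instance of \<open>euclidean_space\<close>, because the latter excludes dimension \<open>0\<close>, that is,
  Courant algebroids over a point.\<close>

locale smooth_manifold =
  fixes atlas :: "('m::{t2_space,second_countable_topology} set \<times> ('m \<Rightarrow> 'b::real_inner)) set"
  assumes finite_dimensional_model: "\<exists>B::'b set. finite B \<and> span B = UNIV"
    and charts_cover: "(\<Union>(U, \<phi>)\<in>atlas. U) = UNIV"
    and chart_open: "(U, \<phi>) \<in> atlas \<Longrightarrow> open U \<and> open (\<phi> ` U)"
    and chart_homeomorphism:
      "(U, \<phi>) \<in> atlas \<Longrightarrow> homeomorphism U (\<phi> ` U) \<phi> (inv_into U \<phi>)"
    and charts_compatible:
      "(U, \<phi>) \<in> atlas \<Longrightarrow> (V, \<psi>) \<in> atlas \<Longrightarrow>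
         smooth_on (\<phi> ` (U \<inter> V)) (\<lambda>y. \<psi> (inv_into U \<phi> y))"
begin

definition smooth_map_on :: "'m set \<Rightarrow> ('m \<Rightarrow> 'c::real_normed_vector) \<Rightarrow> bool" where
  "smooth_map_on W f \<longleftrightarrow>
     (\<forall>(U, \<phi>)\<in>atlas. smooth_on (\<phi> ` (U \<inter> W)) (\<lambda>y. f (inv_into U \<phi> y)))"

definition Cinf :: "('m \<Rightarrow> real) set" where
  "Cinf = {f. smooth_map_on UNIV f}"

text \<open>Tangent vectors are derivations of the algebra of smooth functions. They are normalised
  to vanish on non-smooth functions, so that equality of tangent vectors is equality in HOL.\<close>

definition tangent_space :: "'m \<Rightarrow> (('m \<Rightarrow> real) \<Rightarrow> real) set" where
  "tangent_space x = {X.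
     (\<forall>f\<in>Cinf. \<forall>h\<in>Cinf. X (\<lambda>y. f y + h y) = X f + X h) \<and>
     (\<forall>f\<in>Cinf. \<forall>a. X (\<lambda>y. a * f y) = a * X f) \<and>
     (\<forall>f\<in>Cinf. \<forall>h\<in>Cinf. X (\<lambda>y. f y * h y) = f x * X h + h x * X f) \<and>
     (\<forall>f. f \<notin> Cinf \<longrightarrow> X f = 0)}"

text \<open>The tangent vector at \<open>x\<close> with coordinate vector \<open>v\<close> in the chart \<open>(U, \<phi>)\<close>, i.e.
  \<open>v\<^sup>i \<partial>/\<partial>x\<^sup>i\<close>.\<close>

definition coordinate_vector ::
    "'m set \<times> ('m \<Rightarrow> 'b) \<Rightarrow> 'm \<Rightarrow> 'b \<Rightarrow> (('m \<Rightarrow> real) \<Rightarrow> real)" where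
  "coordinate_vector = (\<lambda>(U, \<phi>) x v f.
     if f \<in> Cinf then frechet_derivative (\<lambda>y. f (inv_into U \<phi> y)) (at (\<phi> x)) v else 0)"

text \<open>Smoothness of a vector field: its components in every chart are smooth.\<close>

definition smooth_vector_field_on :: "'m set \<Rightarrow> ('m \<Rightarrow> ('m \<Rightarrow> real) \<Rightarrow> real) \<Rightarrow> bool" where
  "smooth_vector_field_on W X \<longleftrightarrow>
     (\<forall>x\<in>W. X x \<in> tangent_space x) \<and>
     (\<forall>(U, \<phi>)\<in>atlas. \<exists>c. smooth_map_on (U \<inter> W) c \<and>
        (\<forall>x\<in>U \<inter> W. X x = coordinate_vector (U, \<phi>) x (c x)))"

definition lie_bracket ::
    "('m \<Rightarrow> ('m \<Rightarrow> real) \<Rightarrow> real) \<Rightarrow> ('m \<Rightarrow> ('m \<Rightarrow> real) \<Rightarrow> real) \<Rightarrow> 'm \<Rightarrow> ('m \<Rightarrow> real) \<Rightarrow> real" where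
  "lie_bracket X Y x f =
     (if f \<in> Cinf then X x (\<lambda>y. Y y f) - Y x (\<lambda>y. X y f) else 0)"

end


section \<open>Vector bundles\<close>

text \<open>The bundle is given by its fibres \<open>E x\<close> and an atlas of local trivialisations. A local
  trivialisation of rank \<open>k\<close> over \<open>U\<close> is encoded as the local frame \<open>b 0, \<dots>, b (k - 1)\<close> that
  it carries to the standard basis; smooth compatibility says that the transition matrices are
  smooth. The ambient vector space \<open>'v\<close> only serves to make the fibres vector
  spaces: no topology on it is used and different fibres are not related through it. Every
  family of vector spaces can be so realised, e.g. inside its direct sum.\<close>

locale vector_bundle = smooth_manifold atlas
  for atlas :: "('m::{t2_space,second_countable_topology} set \<times> ('m \<Rightarrow> 'b::real_inner)) set" +
  fixes E :: "'m \<Rightarrow> 'v::real_vector set"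
    and k :: nat
    and frames :: "('m set \<times> (nat \<Rightarrow> 'm \<Rightarrow> 'v)) set"
  assumes fibre_subspace: "subspace (E x)"
    and frames_cover: "(\<Union>(U, b)\<in>frames. U) = UNIV"
    and frame_open: "(U, b) \<in> frames \<Longrightarrow> open U"
    and frame_basis: "(U, b) \<in> frames \<Longrightarrow> x \<in> U \<Longrightarrow>
      inj_on (\<lambda>i. b i x) {..<k} \<and> independent ((\<lambda>i. b i x) ` {..<k}) \<and>
      span ((\<lambda>i. b i x) ` {..<k}) = E x"
    and frames_compatible: "(U, b) \<in> frames \<Longrightarrow> (V, b') \<in> frames \<Longrightarrow>
      \<exists>a :: nat \<Rightarrow> nat \<Rightarrow> 'm \<Rightarrow> real.
        (\<forall>i<k. \<forall>j<k. smooth_map_on (U \<inter> V) (a i j)) \<and>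
        (\<forall>j<k. \<forall>x\<in>U \<inter> V. b' j x = (\<Sum>i<k. a i j x *\<^sub>R b i x))"
begin

definition sections :: "('m \<Rightarrow> 'v) set" where
  "sections = {s. (\<forall>x. s x \<in> E x) \<and>
     (\<forall>(U, b)\<in>frames. \<exists>c :: nat \<Rightarrow> 'm \<Rightarrow> real.
        (\<forall>i<k. smooth_map_on U (c i)) \<and> (\<forall>x\<in>U. s x = (\<Sum>i<k. c i x *\<^sub>R b i x)))}"

end


section \<open>Bundles with a nondegenerate symmetric form and an anchor\<close>

locale anchored_metric_bundle = vector_bundle atlas E k frames
  for atlas :: "('m::{t2_space,second_countable_topology} set \<times> ('m \<Rightarrow> 'b::real_inner)) set"
    and E :: "'m \<Rightarrow> 'v::real_vector set"
    and k :: nat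
    and frames :: "('m set \<times> (nat \<Rightarrow> 'm \<Rightarrow> 'v)) set" +
  fixes g :: "'m \<Rightarrow> 'v \<Rightarrow> 'v \<Rightarrow> real"
    and \<rho> :: "'m \<Rightarrow> 'v \<Rightarrow> ('m \<Rightarrow> real) \<Rightarrow> real"
  assumes form_add: "u \<in> E x \<Longrightarrow> v \<in> E x \<Longrightarrow> w \<in> E x \<Longrightarrow> g x (u + v) w = g x u w + g x v w"
    and form_scale: "u \<in> E x \<Longrightarrow> w \<in> E x \<Longrightarrow> g x (a *\<^sub>R u) w = a * g x u w"
    and form_sym: "u \<in> E x \<Longrightarrow> w \<in> E x \<Longrightarrow> g x u w = g x w u"
    and form_nondegenerate: "u \<in> E x \<Longrightarrow> (\<forall>w\<in>E x. g x u w = 0) \<Longrightarrow> u = 0"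
    and form_smooth: "(U, b) \<in> frames \<Longrightarrow> i < k \<Longrightarrow> j < k \<Longrightarrow>
      smooth_map_on U (\<lambda>x. g x (b i x) (b j x))"
    and anchor_tangent: "u \<in> E x \<Longrightarrow> \<rho> x u \<in> tangent_space x"
    and anchor_add: "u \<in> E x \<Longrightarrow> v \<in> E x \<Longrightarrow> \<rho> x (u + v) = (\<lambda>f. \<rho> x u f + \<rho> x v f)"
    and anchor_scale: "u \<in> E x \<Longrightarrow> \<rho> x (a *\<^sub>R u) = (\<lambda>f. a * \<rho> x u f)"
    and anchor_smooth: "(U, b) \<in> frames \<Longrightarrow> i < k \<Longrightarrow>
      smooth_vector_field_on U (\<lambda>x. \<rho> x (b i x))"
begin

definition pairing :: "('m \<Rightarrow> 'v) \<Rightarrow> ('m \<Rightarrow> 'v) \<Rightarrow> 'm \<Rightarrow> real" where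
  "pairing e h = (\<lambda>x. g x (e x) (h x))"

definition anchor :: "('m \<Rightarrow> 'v) \<Rightarrow> 'm \<Rightarrow> ('m \<Rightarrow> real) \<Rightarrow> real" where
  "anchor e = (\<lambda>x. \<rho> x (e x))"

text \<open>The derivative \<open>\<rho>(e)f\<close> of a function along a section.\<close>

definition anchor_deriv :: "('m \<Rightarrow> 'v) \<Rightarrow> ('m \<Rightarrow> real) \<Rightarrow> 'm \<Rightarrow> real" where
  "anchor_deriv e f = (\<lambda>x. anchor e x f)"

text \<open>Used for smooth \<open>f\<close> only, where the description is uniquely satisfied by
  nondegeneracy of the form.\<close>

definition \<D> :: "('m \<Rightarrow> real) \<Rightarrow> 'm \<Rightarrow> 'v" where
  "\<D> f = (THE s. s \<in> sections \<and> (\<forall>e\<in>sections. pairing s e = anchor_deriv e f))"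

definition jacobiator ::
    "(('m \<Rightarrow> 'v) \<Rightarrow> ('m \<Rightarrow> 'v) \<Rightarrow> 'm \<Rightarrow> 'v) \<Rightarrow> ('m \<Rightarrow> 'v) \<Rightarrow> ('m \<Rightarrow> 'v) \<Rightarrow> ('m \<Rightarrow> 'v) \<Rightarrow> 'm \<Rightarrow> 'v" where
  "jacobiator br e1 e2 e3 =
     (\<lambda>x. br (br e1 e2) e3 x + br (br e2 e3) e1 x + br (br e3 e1) e2 x)"

definition bracket_triple ::
    "(('m \<Rightarrow> 'v) \<Rightarrow> ('m \<Rightarrow> 'v) \<Rightarrow> 'm \<Rightarrow> 'v) \<Rightarrow> ('m \<Rightarrow> 'v) \<Rightarrow> ('m \<Rightarrow> 'v) \<Rightarrow> ('m \<Rightarrow> 'v) \<Rightarrow> 'm \<Rightarrow> real" where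
  "bracket_triple br e1 e2 e3 =
     (\<lambda>x. 1/6 * (pairing (br e1 e2) e3 x + pairing (br e2 e3) e1 x + pairing (br e3 e1) e2 x))"

text \<open>An \<open>\<real>\<close>-bilinear operation on the space of sections; its values on arguments that are not
  smooth sections are irrelevant.\<close>

definition bilinear_operation :: "(('m \<Rightarrow> 'v) \<Rightarrow> ('m \<Rightarrow> 'v) \<Rightarrow> 'm \<Rightarrow> 'v) \<Rightarrow> bool" where
  "bilinear_operation br \<longleftrightarrow>
     (\<forall>e\<in>sections. \<forall>h\<in>sections. br e h \<in> sections) \<and>
     (\<forall>e\<in>sections. \<forall>e'\<in>sections. \<forall>h\<in>sections.
        br (\<lambda>x. e x + e' x) h = (\<lambda>x. br e h x + br e' h x) \<and>
        br h (\<lambda>x. e x + e' x) = (\<lambda>x. br h e x + br h e' x)) \<and>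
     (\<forall>e\<in>sections. \<forall>h\<in>sections. \<forall>a::real.
        br (\<lambda>x. a *\<^sub>R e x) h = (\<lambda>x. a *\<^sub>R br e h x) \<and>
        br h (\<lambda>x. a *\<^sub>R e x) = (\<lambda>x. a *\<^sub>R br h e x))"

end


section \<open>The two notions of Courant algebroid\<close>

locale skew_courant_algebroid = anchored_metric_bundle atlas E k frames g \<rho>
  for atlas :: "('m::{t2_space,second_countable_topology} set \<times> ('m \<Rightarrow> 'b::real_inner)) set"
    and E :: "'m \<Rightarrow> 'v::real_vector set"
    and k :: nat
    and frames :: "('m set \<times> (nat \<Rightarrow> 'm \<Rightarrow> 'v)) set"
    and g :: "'m \<Rightarrow> 'v \<Rightarrow> 'v \<Rightarrow> real"
    and \<rho> :: "'m \<Rightarrow> 'v \<Rightarrow> ('m \<Rightarrow> real) \<Rightarrow> real" +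
  fixes br :: "('m \<Rightarrow> 'v) \<Rightarrow> ('m \<Rightarrow> 'v) \<Rightarrow> 'm \<Rightarrow> 'v"
  assumes bracket_bilinear: "bilinear_operation br"
    and bracket_skew: "e1 \<in> sections \<Longrightarrow> e2 \<in> sections \<Longrightarrow> br e1 e2 = (\<lambda>x. - br e2 e1 x)"
    and bracket_jacobi: "e1 \<in> sections \<Longrightarrow> e2 \<in> sections \<Longrightarrow> e3 \<in> sections \<Longrightarrow>
      jacobiator br e1 e2 e3 = \<D> (bracket_triple br e1 e2 e3)"
    and bracket_anchor: "e1 \<in> sections \<Longrightarrow> e2 \<in> sections \<Longrightarrow>
      anchor (br e1 e2) = lie_bracket (anchor e1) (anchor e2)"
    and bracket_leibniz: "e1 \<in> sections \<Longrightarrow> e2 \<in> sections \<Longrightarrow> f \<in> Cinf \<Longrightarrow>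
      br e1 (\<lambda>x. f x *\<^sub>R e2 x) =
      (\<lambda>x. f x *\<^sub>R br e1 e2 x + anchor_deriv e1 f x *\<^sub>R e2 x - (1/2 * pairing e1 e2 x) *\<^sub>R \<D> f x)"
    and anchor_D: "f \<in> Cinf \<Longrightarrow> anchor (\<D> f) = (\<lambda>x h. 0)"
    and bracket_metric: "e \<in> sections \<Longrightarrow> h1 \<in> sections \<Longrightarrow> h2 \<in> sections \<Longrightarrow>
      anchor_deriv e (pairing h1 h2) =
      (\<lambda>x. pairing (\<lambda>y. br e h1 y + (1/2) *\<^sub>R \<D> (pairing e h1) y) h2 x
         + pairing h1 (\<lambda>y. br e h2 y + (1/2) *\<^sub>R \<D> (pairing e h2) y) x)"

locale leibniz_courant_algebroid = anchored_metric_bundle atlas E k frames g \<rho>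
  for atlas :: "('m::{t2_space,second_countable_topology} set \<times> ('m \<Rightarrow> 'b::real_inner)) set"
    and E :: "'m \<Rightarrow> 'v::real_vector set"
    and k :: nat
    and frames :: "('m set \<times> (nat \<Rightarrow> 'm \<Rightarrow> 'v)) set"
    and g :: "'m \<Rightarrow> 'v \<Rightarrow> 'v \<Rightarrow> real"
    and \<rho> :: "'m \<Rightarrow> 'v \<Rightarrow> ('m \<Rightarrow> real) \<Rightarrow> real" +
  fixes opr :: "('m \<Rightarrow> 'v) \<Rightarrow> ('m \<Rightarrow> 'v) \<Rightarrow> 'm \<Rightarrow> 'v"
  assumes opr_bilinear: "bilinear_operation opr"
    and opr_jacobi: "e1 \<in> sections \<Longrightarrow> e2 \<in> sections \<Longrightarrow> e3 \<in> sections \<Longrightarrow>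
      opr e1 (opr e2 e3) = (\<lambda>x. opr (opr e1 e2) e3 x + opr e2 (opr e1 e3) x)"
    and opr_anchor: "e1 \<in> sections \<Longrightarrow> e2 \<in> sections \<Longrightarrow>
      anchor (opr e1 e2) = lie_bracket (anchor e1) (anchor e2)"
    and opr_leibniz: "e1 \<in> sections \<Longrightarrow> e2 \<in> sections \<Longrightarrow> f \<in> Cinf \<Longrightarrow>
      opr e1 (\<lambda>x. f x *\<^sub>R e2 x) = (\<lambda>x. f x *\<^sub>R opr e1 e2 x + anchor_deriv e1 f x *\<^sub>R e2 x)"
    and opr_square: "e \<in> sections \<Longrightarrow> opr e e = (\<lambda>x. (1/2) *\<^sub>R \<D> (pairing e e) x)"
    and opr_metric: "e \<in> sections \<Longrightarrow> h1 \<in> sections \<Longrightarrow> h2 \<in> sections \<Longrightarrow>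
      anchor_deriv e (pairing h1 h2) = (\<lambda>x. pairing (opr e h1) h2 x + pairing h1 (opr e h2) x)"

end

theory Submission
  imports Defs "Jordan_Normal_Form.Determinant"
begin

text \<open>Write \<open>a \<circ> b\<close> for the operation and \<open>[a, b]\<close> for its skew part. In both conventions the symmetric
  part of \<open>\<circ>\<close> is a gradient, \<open>a \<circ> b + b \<circ> a = \<D>\<langle>a, b\<rangle>\<close>, so that \<open>\<circ>\<close> and the skew bracket determine each
  other, and the anchor, Leibniz and invariance axioms are translated into each other term by term. Two
  points need an argument.

  The first is that \<open>\<rho> \<circ> \<D> = 0\<close> must be derived from the axioms for \<open>\<circ>\<close>. The anchor carries \<open>\<circ>\<close> to the
  Lie bracket, which has no symmetric part, so it kills every \<open>\<D>\<langle>a, b\<rangle>\<close>; since \<open>\<D>\<close> is a derivation, comparing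
  \<open>\<D>\<langle>a, f b\<rangle>\<close> with \<open>\<D>\<langle>a, b\<rangle>\<close> gives \<open>\<langle>a, b\<rangle> \<rho>(\<D>f) = 0\<close>, and nondegeneracy provides sections with
  \<open>\<langle>a, b\<rangle> \<noteq> 0\<close> at any point where \<open>\<D>f \<noteq> 0\<close> (\<open>anchor_D_eq_zero\<close>).

  The second is the Jacobi identity. Invariance of the pairing and compatibility with the anchor give
  \<open>e \<circ> \<D>f = \<D>(\<rho>(e)f)\<close>, whence \<open>\<D>f \<circ> e = 0\<close>. With these rules every double bracket \<open>[[a, b], c]\<close> becomes
  \<open>(a \<circ> b) \<circ> c\<close> up to a gradient, and cyclic summation gives the identity
  \<open>J(a, b, c) - \<D>T(a, b, c) = (a \<circ> b) \<circ> c + b \<circ> (a \<circ> c) - a \<circ> (b \<circ> c)\<close>, which holds before either Jacobi identity is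
  imposed (\<open>jacobiator_skew\<close>). One side vanishes exactly when the other one does, and this proves both directions.

  All of this presupposes that \<open>\<D>f\<close> exists, is smooth and is determined by its pairings with global
  sections. Locally it solves the linear system of the Gram matrix of a frame, and Cramer's rule shows that
  the solution is smooth (\<open>smooth_linear_system\<close>, \<open>exists_gradient\<close>). Uniqueness, like the rules
  for \<open>\<D>\<close> that follow from it, is obtained by testing against a global section through an arbitrary vector, which comes
  from a smooth bump function (\<open>bump_function\<close>, \<open>section_through\<close>).\<close>

(* The bullet and the dollar sign denote the inner product of the model space and not the operations
   on matrix-library vectors. *)
no_notation scalar_prod (infix "\<bullet>" 70)
no_notation vec_index (infixl "$" 100)

section \<open>Closure properties of smooth maps between normed spaces\<close>

lemma differentiable_upto_imp_continuous_on:
  "differentiable_upto n S f \<Longrightarrow> continuous_on S f"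
  by (cases n) (simp_all add: continuous_at_imp_continuous_on differentiable_imp_continuous_within)

lemma differentiable_upto_SucD: "differentiable_upto (Suc n) S f \<Longrightarrow> differentiable_upto n S f"
proof (induction n arbitrary: f)
  case 0
  then show ?case using differentiable_upto_imp_continuous_on[OF 0] by simp
next
  case (Suc n)
  have *: "(\<forall>x\<in>S. f differentiable (at x)) \<and>
      (\<forall>v. differentiable_upto (Suc n) S (\<lambda>x. frechet_derivative f (at x) v))"
    using Suc.prems by (subst (asm) differentiable_upto.simps(2))
  show ?case
    by (subst differentiable_upto.simps(2)) (use * Suc.IH in blast)
qed

lemma differentiable_upto_subset:
  "differentiable_upto n S f \<Longrightarrow> T \<subseteq> S \<Longrightarrow> differentiable_upto n T f"
proof (induction n arbitrary: f)
  case 0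
  then show ?case using continuous_on_subset by simp
next
  case (Suc n)
  then show ?case by (simp add: subset_iff)
qed

lemma frechet_derivative_cong_open:
  assumes "open S" "x \<in> S" "\<And>y. y \<in> S \<Longrightarrow> f y = g y"
  shows "frechet_derivative f (at x) = frechet_derivative g (at x)"
proof -
  have "(f has_derivative D) (at x) \<longleftrightarrow> (g has_derivative D) (at x)" for D
    using has_derivative_transform_within_open[OF _ assms(1,2), of _ D UNIV] assms(3)
    by (metis)
  then show ?thesis by (simp add: frechet_derivative_def)
qed

lemma differentiable_upto_cong:
  assumes "open S" "\<And>x. x \<in> S \<Longrightarrow> f x = g x" "differentiable_upto n S f"
  shows "differentiable_upto n S g"
  using assms(2,3)
proof (induction n arbitrary: f g)
  case 0
  then show ?case by (auto intro: continuous_on_eq)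
next
  case (Suc n)
  have "g differentiable (at x)" if x: "x \<in> S" for x
  proof -
    obtain D where "(f has_derivative D) (at x)"
      using Suc.prems(2) x by (auto simp: differentiable_def)
    then have "(g has_derivative D) (at x)"
      by (rule has_derivative_transform_within_open[OF _ assms(1) x Suc.prems(1)])
    then show ?thesis by (auto simp: differentiable_def)
  qed
  moreover have "differentiable_upto n S (\<lambda>x. frechet_derivative g (at x) v)" for v
  proof (rule Suc.IH[of "\<lambda>x. frechet_derivative f (at x) v"])
    show "differentiable_upto n S (\<lambda>x. frechet_derivative f (at x) v)"
      using Suc.prems(2) by simp
  qed (use frechet_derivative_cong_open[OF assms(1)] Suc.prems(1) in metis)
  ultimately show ?case by simp
qed

lemma differentiable_upto_SucI:
  assumes "open S" "\<And>x. x \<in> S \<Longrightarrow> (f has_derivative F x) (at x)"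
    and "\<And>v. differentiable_upto n S (\<lambda>x. F x v)"
  shows "differentiable_upto (Suc n) S f"
proof -
  have "differentiable_upto n S (\<lambda>x. frechet_derivative f (at x) v)" for v
    by (rule differentiable_upto_cong[OF assms(1) _ assms(3)[of v]])
       (simp add: frechet_derivative_at[OF assms(2), symmetric])
  then show ?thesis using assms(2) by (auto simp: differentiable_def)
qed

lemma differentiable_upto_local:
  assumes "\<And>x. x \<in> S \<Longrightarrow> \<exists>T. open T \<and> x \<in> T \<and> differentiable_upto n T f"
  shows "differentiable_upto n S f"
  using assms
proof (induction n arbitrary: f)
  case 0
  have "continuous (at x within S) f" if "x \<in> S" for x
    using 0[OF that] by (metis at_within_open continuous_at_imp_continuous_at_within
        continuous_on_eq_continuous_within differentiable_upto.simps(1))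
  then show ?case by (simp add: continuous_on_eq_continuous_within)
next
  case (Suc n)
  have T: "\<exists>T. open T \<and> x \<in> T \<and> (\<forall>y\<in>T. f differentiable (at y)) \<and>
      (\<forall>v. differentiable_upto n T (\<lambda>x. frechet_derivative f (at x) v))" if "x \<in> S" for x
    using Suc.prems[OF that] by simp
  have "differentiable_upto n S (\<lambda>x. frechet_derivative f (at x) v)" for v
    by (rule Suc.IH) (use T in blast)
  then show ?case using T by auto
qed

lemma differentiable_upto_const: "differentiable_upto n S (\<lambda>x. c)"
  by (induction n arbitrary: c) simp_all

lemma differentiable_upto_add:
  assumes "open S" "differentiable_upto n S f" "differentiable_upto n S g"
  shows "differentiable_upto n S (\<lambda>x. f x + g x)"
  using assms(2,3)
proof (induction n arbitrary: f g)
  case 0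
  then show ?case by (simp add: continuous_on_add)
next
  case (Suc n)
  have *: "((\<lambda>x. f x + g x) has_derivative
      (\<lambda>v. frechet_derivative f (at x) v + frechet_derivative g (at x) v)) (at x)" if "x \<in> S" for x
    using Suc.prems that by (intro has_derivative_add) (auto simp: frechet_derivative_works[symmetric])
  show ?case
    by (rule differentiable_upto_SucI[OF assms(1) *]) (use Suc in simp_all)
qed

text \<open>One induction covers multiplication, scaling and the inner product, because the derivative
  of a bilinear expression is a sum of two expressions of the same bilinear form.\<close>

lemma (in bounded_bilinear) differentiable_upto:
  assumes "open S" "differentiable_upto n S f" "differentiable_upto n S g"
  shows "differentiable_upto n S (\<lambda>x. prod (f x) (g x))"
  using assms(2,3)
proof (induction n arbitrary: f g)
  case 0
  then show ?case by (simp add: continuous_on)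
next
  case (Suc n)
  have *: "((\<lambda>x. prod (f x) (g x)) has_derivative
      (\<lambda>v. prod (f x) (frechet_derivative g (at x) v) + prod (frechet_derivative f (at x) v) (g x))) (at x)"
    if "x \<in> S" for x
    using Suc.prems that by (intro FDERIV) (auto simp: frechet_derivative_works[symmetric])
  show ?case
  proof (rule differentiable_upto_SucI[OF assms(1) *])
    show "differentiable_upto n S
      (\<lambda>x. prod (f x) (frechet_derivative g (at x) v) + prod (frechet_derivative f (at x) v) (g x))" for v
      using Suc.prems differentiable_upto_SucD[OF Suc.prems(1)] differentiable_upto_SucD[OF Suc.prems(2)]
      by (intro differentiable_upto_add assms(1) Suc.IH) simp_all
  qed
qed

lemma differentiable_upto_inverse:
  fixes f :: "'a::real_normed_vector \<Rightarrow> real"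
  assumes "open S" "\<And>x. x \<in> S \<Longrightarrow> f x \<noteq> 0" "differentiable_upto n S f"
  shows "differentiable_upto n S (\<lambda>x. inverse (f x))"
  using assms(3)
proof (induction n)
  case 0
  then show ?case using assms(2) by (auto intro: continuous_on_inverse)
next
  case (Suc n)
  have *: "((\<lambda>x. inverse (f x)) has_derivative
      (\<lambda>v. - (inverse (f x) * frechet_derivative f (at x) v * inverse (f x)))) (at x)"
    if "x \<in> S" for x
    using Suc.prems that assms(2)
    by (intro Deriv.has_derivative_inverse) (auto simp: frechet_derivative_works[symmetric])
  show ?case
  proof (rule differentiable_upto_SucI[OF assms(1) *])
    have "differentiable_upto n S
      (\<lambda>x. (- 1) * (inverse (f x) * frechet_derivative f (at x) v * inverse (f x)))" for v
      using Suc.prems differentiable_upto_SucD[OF Suc.prems]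
      by (intro bounded_bilinear.differentiable_upto[OF bounded_bilinear_mult] assms(1)
          differentiable_upto_const Suc.IH) simp_all
    then show "differentiable_upto n S
      (\<lambda>x. - (inverse (f x) * frechet_derivative f (at x) v * inverse (f x)))" for v
      by simp
  qed
qed

lemma smooth_on_cong:
  "open S \<Longrightarrow> (\<And>x. x \<in> S \<Longrightarrow> f x = g x) \<Longrightarrow> smooth_on S f \<Longrightarrow> smooth_on S g"
  unfolding smooth_on_def by (blast intro: differentiable_upto_cong)

lemma smooth_on_subset: "smooth_on S f \<Longrightarrow> T \<subseteq> S \<Longrightarrow> smooth_on T f"
  unfolding smooth_on_def by (blast intro: differentiable_upto_subset)

lemma smooth_on_local:
  assumes "\<And>x. x \<in> S \<Longrightarrow> \<exists>T. open T \<and> x \<in> T \<and> smooth_on T f"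
  shows "smooth_on S f"
  unfolding smooth_on_def
proof
  fix n
  show "differentiable_upto n S f"
  proof (rule differentiable_upto_local)
    fix x assume "x \<in> S"
    from assms[OF this] show "\<exists>T. open T \<and> x \<in> T \<and> differentiable_upto n T f"
      by (auto simp: smooth_on_def)
  qed
qed

lemma smooth_on_const: "smooth_on S (\<lambda>x. c)"
  by (simp add: smooth_on_def differentiable_upto_const)

lemma smooth_on_add:
  "open S \<Longrightarrow> smooth_on S f \<Longrightarrow> smooth_on S g \<Longrightarrow> smooth_on S (\<lambda>x. f x + g x)"
  by (simp add: smooth_on_def differentiable_upto_add)

lemma (in bounded_bilinear) smooth_on:
  "open S \<Longrightarrow> smooth_on S f \<Longrightarrow> smooth_on S g \<Longrightarrow> smooth_on S (\<lambda>x. prod (f x) (g x))"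
  by (simp add: smooth_on_def differentiable_upto)

lemma smooth_on_inverse:
  fixes f :: "'a::real_normed_vector \<Rightarrow> real"
  shows "open S \<Longrightarrow> (\<And>x. x \<in> S \<Longrightarrow> f x \<noteq> 0) \<Longrightarrow> smooth_on S f \<Longrightarrow> smooth_on S (\<lambda>x. inverse (f x))"
  by (simp add: smooth_on_def differentiable_upto_inverse)

lemma smooth_on_sum:
  assumes "open S" "\<And>i. i \<in> I \<Longrightarrow> smooth_on S (f i)"
  shows "smooth_on S (\<lambda>x. \<Sum>i\<in>I. f i x)"
  using assms(2)
proof (induction I rule: infinite_finite_induct)
  case (insert i I)
  then show ?case by (simp add: smooth_on_add[OF assms(1)])
qed (simp_all add: smooth_on_const)

lemma orthogonal_expansion:
  assumes "\<exists>B::'a::real_inner set. finite B \<and> span B = UNIV"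
  obtains C :: "'a::real_inner set" where "finite C" "\<And>v. v = (\<Sum>b\<in>C. (v \<bullet> b / (b \<bullet> b)) *\<^sub>R b)"
proof -
  obtain C :: "'a set" where C: "finite C" "span C = UNIV" "pairwise real_inner_class.orthogonal C"
    using assms basis_orthogonal by metis
  have "v = (\<Sum>b\<in>C. (v \<bullet> b / (b \<bullet> b)) *\<^sub>R b)" for v
  proof -
    let ?w = "v - (\<Sum>b\<in>C. (v \<bullet> b / (b \<bullet> b)) *\<^sub>R b)"
    have "real_inner_class.orthogonal ?w c" if c: "c \<in> C" for c
    proof -
      have "(\<Sum>b\<in>C. (v \<bullet> b / (b \<bullet> b)) *\<^sub>R b) \<bullet> c = (\<Sum>b\<in>C. if b = c then v \<bullet> c else 0)"
        unfolding inner_sum_left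
        using C(3) c by (intro sum.cong) (auto simp: pairwise_def real_inner_class.orthogonal_def)
      then show ?thesis
        using C(1) c by (simp add: real_inner_class.orthogonal_def inner_diff_left)
    qed
    then have "real_inner_class.orthogonal ?w ?w"
      using orthogonal_to_span[of ?w C ?w] C(2) by simp
    then show ?thesis
      by (simp add: orthogonal_self)
  qed
  then show ?thesis using that C(1) by blast
qed

text \<open>The directional derivative along a varying vector: in a finite orthogonal spanning set the
  vector has smooth coordinates, and the iterated derivatives in constant directions are smooth by
  definition.\<close>

lemma smooth_on_frechet_derivative_along:
  fixes f :: "'a::real_inner \<Rightarrow> 'c::real_normed_vector" and c :: "'a \<Rightarrow> 'a"
  assumes fin: "\<exists>B::'a set. finite B \<and> span B = UNIV"
    and S: "open S" and f: "smooth_on S f" and c: "smooth_on S c"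
  shows "smooth_on S (\<lambda>x. frechet_derivative f (at x) (c x))"
proof -
  obtain C :: "'a set" where C: "finite C" and coords: "\<And>v. v = (\<Sum>b\<in>C. (v \<bullet> b / (b \<bullet> b)) *\<^sub>R b)"
    using orthogonal_expansion[OF fin] by blast
  have df: "f differentiable (at x)" if "x \<in> S" for x
    using f that unfolding smooth_on_def by (metis differentiable_upto.simps(2))
  have smooth_df: "smooth_on S (\<lambda>x. frechet_derivative f (at x) v)" for v
    using f unfolding smooth_on_def by (metis differentiable_upto.simps(2))
  have smooth_sum: "smooth_on S (\<lambda>x. \<Sum>b\<in>C. ((c x \<bullet> b) * inverse (b \<bullet> b)) *\<^sub>R frechet_derivative f (at x) b)"
    by (intro smooth_on_sum S bounded_bilinear.smooth_on[OF bounded_bilinear_scaleR]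
        bounded_bilinear.smooth_on[OF bounded_bilinear_mult]
        bounded_bilinear.smooth_on[OF bounded_bilinear_inner] smooth_df c smooth_on_const)
  have "frechet_derivative f (at x) (c x)
      = (\<Sum>b\<in>C. ((c x \<bullet> b) * inverse (b \<bullet> b)) *\<^sub>R frechet_derivative f (at x) b)" if "x \<in> S" for x
  proof -
    interpret linear "frechet_derivative f (at x)"
      using df[OF that] by (rule linear_frechet_derivative)
    show ?thesis
      by (subst coords[of "c x"]) (simp add: sum scale divide_inverse)
  qed
  then show ?thesis
    by (intro smooth_on_cong[OF S _ smooth_sum]) simp
qed

section \<open>A smooth function vanishing on the negative axis\<close>

text \<open>The functions \<open>t\<^sup>-\<^sup>m e\<^sup>-\<^sup>1\<^sup>/\<^sup>t\<close>, extended by zero to \<open>t \<le> 0\<close>: the whole family is kept because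
  its span is closed under differentiation.\<close>

definition flat :: "nat \<Rightarrow> real \<Rightarrow> real" where
  "flat m t = (if t > 0 then inverse t ^ m * exp (- inverse t) else 0)"

lemma flat_at_zero: "(flat m \<longlongrightarrow> 0) (at 0)"
proof -
  have "((\<lambda>t::real. inverse t ^ m / exp (inverse t)) \<longlongrightarrow> 0) (at_right 0)"
    using filterlim_compose[OF tendsto_power_div_exp_0 filterlim_inverse_at_top_right] .
  moreover have "eventually (\<lambda>t::real. inverse t ^ m / exp (inverse t) = flat m t) (at_right 0)"
    using eventually_at_right_less[of 0]
    by eventually_elim (simp add: flat_def exp_minus divide_inverse)
  ultimately have "(flat m \<longlongrightarrow> 0) (at_right 0)"
    by (rule Lim_transform_eventually)
  moreover have "(flat m \<longlongrightarrow> 0) (at_left 0)"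
    by (rule Lim_transform_eventually[OF tendsto_const])
       (auto simp: eventually_at_filter flat_def)
  ultimately show ?thesis
    by (simp add: filterlim_at_split)
qed

lemma flat_has_derivative:
  "(flat m has_real_derivative flat (m + 2) t - real m * flat (m + 1) t) (at t)"
proof -
  consider "t > 0" | "t < 0" | "t = 0" by linarith
  then show ?thesis
  proof cases
    case 1
    have "((\<lambda>t. inverse t ^ m * exp (- inverse t)) has_real_derivative
        flat (m + 2) t - real m * flat (m + 1) t) (at t)"
    proof (cases m)
      case 0
      then show ?thesis
        using 1 by (auto intro!: derivative_eq_intros simp: flat_def power2_eq_square)
    next
      case (Suc k)
      have "((\<lambda>t. inverse t ^ Suc k * exp (- inverse t)) has_real_derivative
          (real (Suc k) * (- (inverse t * inverse t)) * inverse t ^ k) * exp (- inverse t)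
          + (exp (- inverse t) * (inverse t * inverse t)) * inverse t ^ Suc k) (at t)"
        by (rule derivative_eq_intros refl | use 1 in simp)+
      then show ?thesis
        unfolding Suc by (rule DERIV_cong) (use 1 in \<open>simp add: flat_def algebra_simps\<close>)
    qed
    then show ?thesis
      by (rule has_field_derivative_transform_within_open[where S = "{0<..}"])
         (use 1 in \<open>auto simp: flat_def\<close>)
  next
    case 2
    show ?thesis
      by (rule has_field_derivative_transform_within_open[where S = "{..<0}" and f = "\<lambda>t. 0"])
         (use 2 in \<open>auto simp: flat_def\<close>)
  next
    case 3
    have "((\<lambda>h. (flat m (0 + h) - flat m 0) / h) \<longlongrightarrow> 0) (at 0)"
      by (rule Lim_transform_eventually[OF flat_at_zero[of "Suc m"]])
         (auto simp: flat_def eventually_at_filter divide_inverse)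
    then show ?thesis
      unfolding 3 DERIV_def by (simp add: flat_def)
  qed
qed

lemma smooth_on_flat:
  fixes f :: "'a::real_normed_vector \<Rightarrow> real"
  assumes "open S" "smooth_on S f"
  shows "smooth_on S (\<lambda>x. flat m (f x))"
proof -
  have "differentiable_upto n S (\<lambda>x. flat m (f x))" for n
  proof (induction n arbitrary: m)
    case 0
    have "continuous_on UNIV (flat m)"
      using flat_has_derivative by (meson DERIV_isCont continuous_at_imp_continuous_on)
    moreover have "continuous_on S f"
      using assms(2) by (auto simp: smooth_on_def dest: spec[of _ 0])
    ultimately show ?case
      by (simp add: continuous_on_compose2[of UNIV "flat m" S f])
  next
    case (Suc n)
    have f: "differentiable_upto k S f" for k
      using assms(2) by (simp add: smooth_on_def)
    let ?d = "\<lambda>x v. (flat (m + 2) (f x) + (- real m) * flat (m + 1) (f x)) * frechet_derivative f (at x) v"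
    have *: "((\<lambda>x. flat m (f x)) has_derivative ?d x) (at x)" if "x \<in> S" for x
    proof -
      have "(f has_derivative frechet_derivative f (at x)) (at x)"
        using f[of 1] that by (simp add: frechet_derivative_works[symmetric])
      from has_derivative_compose[OF this flat_has_derivative[unfolded has_field_derivative_def]]
      show ?thesis by simp
    qed
    show ?case
    proof (rule differentiable_upto_SucI[OF assms(1) *])
      show "differentiable_upto n S (\<lambda>x. ?d x v)" for v
        using f[of "Suc n"]
        by (intro bounded_bilinear.differentiable_upto[OF bounded_bilinear_mult] assms(1)
            differentiable_upto_add differentiable_upto_const Suc.IH) simp_all
    qed
  qed
  then show ?thesis by (simp add: smooth_on_def)
qed

section \<open>Compactness of balls in the model space\<close>

text \<open>The model space carries no distinguished basis, so compactness is obtained from an orthogonal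
  spanning set: a ball is a closed part of the set of combinations with coefficients in \<open>[-R, R]\<close>,
  which is compact as a sum of finitely many segments.\<close>

lemma compact_cball_finite_dimensional:
  fixes p :: "'a::real_inner"
  assumes "\<exists>B::'a set. finite B \<and> span B = UNIV"
  shows "compact (cball p r)"
proof -
  obtain C :: "'a set" where C: "finite C" and coords: "\<And>v. v = (\<Sum>b\<in>C. (v \<bullet> b / (b \<bullet> b)) *\<^sub>R b)"
    using orthogonal_expansion[OF assms] by blast
  define K where "K R D = {\<Sum>b\<in>D. u b *\<^sub>R b | u. \<forall>b\<in>D. \<bar>u b\<bar> \<le> R}" for R and D :: "'a set"
  have compact_K: "compact (K R D)" if "finite D" for R D
    using that
  proof (induction D rule: finite_induct)
    case empty
    then show ?case by (simp add: K_def)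
  next
    case (insert d D)
    have "K R (insert d D) = {x + y | x y. x \<in> (\<lambda>t. t *\<^sub>R d) ` {-R..R} \<and> y \<in> K R D}"
    proof (intro equalityI subsetI)
      fix z assume "z \<in> K R (insert d D)"
      then obtain u where "\<forall>b\<in>insert d D. \<bar>u b\<bar> \<le> R" "z = u d *\<^sub>R d + (\<Sum>b\<in>D. u b *\<^sub>R b)"
        using insert.hyps by (auto simp: K_def)
      then show "z \<in> {x + y | x y. x \<in> (\<lambda>t. t *\<^sub>R d) ` {-R..R} \<and> y \<in> K R D}"
        unfolding K_def by (force simp: abs_le_iff)
    next
      fix z assume "z \<in> {x + y | x y. x \<in> (\<lambda>t. t *\<^sub>R d) ` {-R..R} \<and> y \<in> K R D}"
      then obtain t y where ty: "t \<in> {-R..R}" "y \<in> K R D" "z = t *\<^sub>R d + y"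
        by blast
      then obtain u where "\<forall>b\<in>D. \<bar>u b\<bar> \<le> R" "y = (\<Sum>b\<in>D. u b *\<^sub>R b)"
        unfolding K_def by blast
      with ty have tu: "\<bar>t\<bar> \<le> R" "\<forall>b\<in>D. \<bar>u b\<bar> \<le> R" "z = t *\<^sub>R d + (\<Sum>b\<in>D. u b *\<^sub>R b)"
        by (auto simp: abs_le_iff)
      have "(\<Sum>b\<in>D. (u(d := t)) b *\<^sub>R b) = (\<Sum>b\<in>D. u b *\<^sub>R b)"
        using insert.hyps by (intro sum.cong) auto
      then have "z = (\<Sum>b\<in>insert d D. (u(d := t)) b *\<^sub>R b)"
        using insert.hyps tu by simp
      moreover have "\<forall>b\<in>insert d D. \<bar>(u(d := t)) b\<bar> \<le> R"
        using tu by auto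
      ultimately show "z \<in> K R (insert d D)"
        unfolding K_def by blast
    qed
    moreover have "compact ((\<lambda>t. t *\<^sub>R d) ` {-R..R})"
      by (intro compact_continuous_image continuous_intros) auto
    ultimately show ?case
      using compact_sums[OF _ insert.IH, of "(\<lambda>t. t *\<^sub>R d) ` {-R..R}"] by simp
  qed
  have "compact (cball 0 \<bar>r\<bar> :: 'a set)"
  proof -
    (* By Cauchy-Schwarz each coefficient is at most its own summand; the sum bounds all of them. *)
    define R where "R = (\<Sum>b\<in>C. \<bar>r\<bar> * norm b / (b \<bullet> b))"
    have "cball 0 \<bar>r\<bar> \<subseteq> K R C"
    proof
      fix v :: 'a assume "v \<in> cball 0 \<bar>r\<bar>"
      then have v: "norm v \<le> \<bar>r\<bar>" by simp
      have "\<bar>v \<bullet> b / (b \<bullet> b)\<bar> \<le> R" if "b \<in> C" for b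
      proof -
        have "\<bar>v \<bullet> b\<bar> \<le> \<bar>r\<bar> * norm b"
          using Cauchy_Schwarz_ineq2[of v b] v by (meson mult_right_mono norm_ge_zero order_trans)
        then have "\<bar>v \<bullet> b / (b \<bullet> b)\<bar> \<le> \<bar>r\<bar> * norm b / (b \<bullet> b)"
          by (simp add: divide_right_mono)
        also have "\<dots> \<le> R"
          unfolding R_def using C that by (intro member_le_sum) auto
        finally show ?thesis .
      qed
      then show "v \<in> K R C"
        using coords[of v] unfolding K_def by (intro CollectI exI[of _ "\<lambda>b. v \<bullet> b / (b \<bullet> b)"]) simp
    qed
    then show ?thesis
      using compact_Int_closed[OF compact_K[OF C, of R], of "cball 0 \<bar>r\<bar>"] by (simp add: Int_absorb1)
  qed
  then have "compact ((+) p ` cball 0 \<bar>r\<bar>)"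
    by (rule compact_translation)
  then show ?thesis
    by (cases "r \<ge> 0") (simp_all add: image_add_cball)
qed

section \<open>Smooth functions on a manifold\<close>

context smooth_manifold
begin

lemma chart_domain_image_open:
  assumes "(U, \<phi>) \<in> atlas" "open W"
  shows "open (\<phi> ` (U \<inter> W))"
proof -
  have "openin (top_of_set (\<phi> ` U)) (\<phi> ` (U \<inter> W))"
    using homeomorphism_imp_open_map[OF chart_homeomorphism[OF assms(1)]] assms(2)
    by (simp add: openin_open_Int)
  then show ?thesis
    using chart_open[OF assms(1)] openin_open_eq by blast
qed

lemma chart_inv: "(U, \<phi>) \<in> atlas \<Longrightarrow> y \<in> U \<Longrightarrow> inv_into U \<phi> (\<phi> y) = y"
  by (rule homeomorphism_apply1[OF chart_homeomorphism])

lemma chart_at: obtains U \<phi> where "(U, \<phi>) \<in> atlas" "x \<in> U"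
proof -
  have "x \<in> (\<Union>(U, \<phi>)\<in>atlas. U)" using charts_cover by simp
  then show ?thesis using that by auto
qed

lemma smooth_map_onI:
  assumes "\<And>U \<phi>. (U, \<phi>) \<in> atlas \<Longrightarrow> smooth_on (\<phi> ` (U \<inter> W)) (\<lambda>y. f (inv_into U \<phi> y))"
  shows "smooth_map_on W f"
  unfolding smooth_map_on_def using assms by blast

lemma smooth_map_onD:
  "smooth_map_on W f \<Longrightarrow> (U, \<phi>) \<in> atlas \<Longrightarrow> smooth_on (\<phi> ` (U \<inter> W)) (\<lambda>y. f (inv_into U \<phi> y))"
  unfolding smooth_map_on_def by blast

lemma smooth_map_on_cong:
  assumes "open W" "smooth_map_on W f" "\<And>x. x \<in> W \<Longrightarrow> f x = h x"
  shows "smooth_map_on W h"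
proof (rule smooth_map_onI)
  fix U \<phi> assume ch: "(U, \<phi>) \<in> atlas"
  show "smooth_on (\<phi> ` (U \<inter> W)) (\<lambda>y. h (inv_into U \<phi> y))"
    by (rule smooth_on_cong[OF chart_domain_image_open[OF ch assms(1)] _ smooth_map_onD[OF assms(2) ch]])
       (use chart_inv[OF ch] assms(3) in auto)
qed

lemma smooth_map_on_subset: "smooth_map_on W f \<Longrightarrow> T \<subseteq> W \<Longrightarrow> smooth_map_on T f"
  by (rule smooth_map_onI, rule smooth_on_subset, erule (1) smooth_map_onD) auto

lemma smooth_map_on_local:
  assumes "\<And>x. x \<in> W \<Longrightarrow> \<exists>T. open T \<and> x \<in> T \<and> smooth_map_on T f"
  shows "smooth_map_on W f"
proof (rule smooth_map_onI, rule smooth_on_local)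
  fix U \<phi> y assume ch: "(U, \<phi>) \<in> atlas" and "y \<in> \<phi> ` (U \<inter> W)"
  then obtain x where x: "x \<in> U" "x \<in> W" "y = \<phi> x" by auto
  from assms[OF x(2)] obtain T where T: "open T" "x \<in> T" "smooth_map_on T f" by auto
  show "\<exists>T. open T \<and> y \<in> T \<and> smooth_on T (\<lambda>y. f (inv_into U \<phi> y))"
    using chart_domain_image_open[OF ch T(1)] smooth_map_onD[OF T(3) ch] x T(2) by blast
qed

lemma smooth_map_on_const: "smooth_map_on W (\<lambda>x. c)"
  by (rule smooth_map_onI) (rule smooth_on_const)

lemma smooth_map_on_add:
  "open W \<Longrightarrow> smooth_map_on W f \<Longrightarrow> smooth_map_on W h \<Longrightarrow> smooth_map_on W (\<lambda>x. f x + h x)"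
  by (rule smooth_map_onI, rule smooth_on_add, erule (1) chart_domain_image_open)
     (erule (1) smooth_map_onD)+

lemma smooth_map_on_bilinear:
  "bounded_bilinear B \<Longrightarrow> open W \<Longrightarrow> smooth_map_on W f \<Longrightarrow> smooth_map_on W h
    \<Longrightarrow> smooth_map_on W (\<lambda>x. B (f x) (h x))"
  by (rule smooth_map_onI, rule bounded_bilinear.smooth_on[of B], assumption,
      erule (1) chart_domain_image_open) (erule (1) smooth_map_onD)+

lemmas smooth_map_on_mult = smooth_map_on_bilinear[OF bounded_bilinear_mult]

lemma smooth_map_on_inverse:
  fixes f :: "'m \<Rightarrow> real"
  assumes "open W" "smooth_map_on W f" "\<And>x. x \<in> W \<Longrightarrow> f x \<noteq> 0"
  shows "smooth_map_on W (\<lambda>x. inverse (f x))"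
proof (rule smooth_map_onI)
  fix U \<phi> assume ch: "(U, \<phi>) \<in> atlas"
  show "smooth_on (\<phi> ` (U \<inter> W)) (\<lambda>y. inverse (f (inv_into U \<phi> y)))"
    by (rule smooth_on_inverse[OF chart_domain_image_open[OF ch assms(1)] _ smooth_map_onD[OF assms(2) ch]])
       (use chart_inv[OF ch] assms(3) in auto)
qed

lemma smooth_map_on_flat:
  fixes f :: "'m \<Rightarrow> real"
  shows "open W \<Longrightarrow> smooth_map_on W f \<Longrightarrow> smooth_map_on W (\<lambda>x. flat m (f x))"
  by (rule smooth_map_onI, rule smooth_on_flat, erule (1) chart_domain_image_open)
     (erule (1) smooth_map_onD)

lemma smooth_map_on_sum:
  assumes "open W" "\<And>i. i \<in> I \<Longrightarrow> smooth_map_on W (f i)"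
  shows "smooth_map_on W (\<lambda>x. \<Sum>i\<in>I. f i x)"
  using assms(2)
proof (induction I rule: infinite_finite_induct)
  case (insert i I)
  then show ?case by (simp add: smooth_map_on_add[OF assms(1)])
qed (simp_all add: smooth_map_on_const)

lemma smooth_map_on_prod:
  fixes f :: "'i \<Rightarrow> 'm \<Rightarrow> real"
  assumes "open W" "\<And>i. i \<in> I \<Longrightarrow> smooth_map_on W (f i)"
  shows "smooth_map_on W (\<lambda>x. \<Prod>i\<in>I. f i x)"
  using assms(2)
proof (induction I rule: infinite_finite_induct)
  case (insert i I)
  then show ?case by (simp add: smooth_map_on_mult[OF assms(1)])
qed (simp_all add: smooth_map_on_const)

lemma Cinf_iff_smooth_map_on: "f \<in> Cinf \<longleftrightarrow> smooth_map_on UNIV f"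
  by (simp add: Cinf_def)

lemma Cinf_const: "(\<lambda>x. c) \<in> Cinf"
  and Cinf_add: "f \<in> Cinf \<Longrightarrow> h \<in> Cinf \<Longrightarrow> (\<lambda>x. f x + h x) \<in> Cinf"
  and Cinf_mult: "f \<in> Cinf \<Longrightarrow> h \<in> Cinf \<Longrightarrow> (\<lambda>x. f x * h x) \<in> Cinf"
  by (simp_all add: Cinf_iff_smooth_map_on smooth_map_on_const smooth_map_on_add smooth_map_on_mult)

lemma Cinf_scale: "f \<in> Cinf \<Longrightarrow> (\<lambda>x. a * f x) \<in> Cinf"
  by (rule Cinf_mult[OF Cinf_const])

text \<open>In a chart the bump is, up to a constant factor, \<open>flat 0 (r\<^sup>2 - \<parallel>\<phi> y - \<phi> x\<parallel>\<^sup>2)\<close>, which is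
  smooth and supported in a closed ball. The ball is
  compact, so its image \<open>K\<close> in the Hausdorff space is closed, and the extension by zero is smooth on
  the open complement of \<open>K\<close> as well.\<close>

lemma bump_function:
  assumes "open W" "x \<in> W"
  obtains \<eta> K where "\<eta> \<in> Cinf" "\<eta> x = 1" "closed K" "K \<subseteq> W" "\<And>y. y \<notin> K \<Longrightarrow> \<eta> y = 0"
proof -
  obtain U \<phi> where ch: "(U, \<phi>) \<in> atlas" "x \<in> U" by (rule chart_at)
  have openU: "open U" using chart_open[OF ch(1)] by simp
  obtain r where r: "r > 0" "cball (\<phi> x) r \<subseteq> \<phi> ` (U \<inter> W)"
    using chart_domain_image_open[OF ch(1) assms(1)] ch(2) assms(2) open_contains_cball
    by (metis IntI image_eqI)
  define K where "K = inv_into U \<phi> ` cball (\<phi> x) r"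
  have K: "K \<subseteq> U \<inter> W"
    using r(2) chart_inv[OF ch(1)] unfolding K_def by fastforce
  have "continuous_on (cball (\<phi> x) r) (inv_into U \<phi>)"
    using homeomorphism_cont2[OF chart_homeomorphism[OF ch(1)]] r(2)
    by (meson Int_lower1 continuous_on_subset image_mono order_trans)
  then have "closed K"
    unfolding K_def
    by (intro compact_imp_closed compact_continuous_image
        compact_cball_finite_dimensional finite_dimensional_model)
  define q where "q y = r\<^sup>2 - (\<phi> y - \<phi> x) \<bullet> (\<phi> y - \<phi> x)" for y
  define \<eta> where "\<eta> y = (if y \<in> U then inverse (flat 0 (r\<^sup>2)) * flat 0 (q y) else 0)" for y
  have out: "\<eta> y = 0" if "y \<notin> K" for y
  proof (cases "y \<in> U")
    case True
    then have "\<phi> y \<notin> cball (\<phi> x) r"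
      using that chart_inv[OF ch(1) True] unfolding K_def by force
    then have "r < norm (\<phi> y - \<phi> x)"
      by (simp add: dist_norm norm_minus_commute)
    then have "r\<^sup>2 < (norm (\<phi> y - \<phi> x))\<^sup>2"
      using r(1) by (simp add: power_strict_mono)
    then show ?thesis
      by (simp add: \<eta>_def q_def flat_def power2_norm_eq_inner)
  qed (simp add: \<eta>_def)
  have "smooth_map_on U \<phi>"
    using charts_compatible[OF _ ch(1)] by (intro smooth_map_onI) simp
  then have "smooth_map_on U (\<lambda>y. \<phi> y + (- \<phi> x))"
    by (intro smooth_map_on_add openU smooth_map_on_const)
  from smooth_map_on_bilinear[OF bounded_bilinear_inner openU this this]
  have "smooth_map_on U (\<lambda>y. r\<^sup>2 + (- 1) * ((\<phi> y + (- \<phi> x)) \<bullet> (\<phi> y + (- \<phi> x))))"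
    by (intro smooth_map_on_add smooth_map_on_mult openU smooth_map_on_const)
  then have "smooth_map_on U q"
    by (rule smooth_map_on_cong[OF openU]) (simp add: q_def)
  then have "smooth_map_on U (\<lambda>y. inverse (flat 0 (r\<^sup>2)) * flat 0 (q y))"
    by (intro smooth_map_on_mult smooth_map_on_flat openU smooth_map_on_const)
  then have 1: "smooth_map_on U \<eta>"
    by (rule smooth_map_on_cong[OF openU]) (simp add: \<eta>_def)
  have 2: "smooth_map_on (- K) \<eta>"
    by (rule smooth_map_on_cong[OF _ smooth_map_on_const[of _ 0]])
       (use \<open>closed K\<close> out in \<open>auto simp: open_Compl\<close>)
  have "smooth_map_on UNIV \<eta>"
  proof (rule smooth_map_on_local)
    fix y
    show "\<exists>T. open T \<and> y \<in> T \<and> smooth_map_on T \<eta>"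
      using 1 2 openU \<open>closed K\<close> K by (cases "y \<in> U") (auto intro: open_Compl)
  qed
  moreover have "\<eta> x = 1"
    using ch(2) r(1) by (simp add: \<eta>_def q_def flat_def)
  ultimately show ?thesis
    using that[of \<eta> K] \<open>closed K\<close> K out by (auto simp: Cinf_iff_smooth_map_on)
qed

text \<open>In a chart, \<open>X f\<close> is the derivative of \<open>f\<close> along the smooth coordinate vector of \<open>X\<close>.\<close>

lemma smooth_vector_field_derivative:
  assumes "open W" "smooth_vector_field_on W X" "f \<in> Cinf"
  shows "smooth_map_on W (\<lambda>x. X x f)"
proof (rule smooth_map_onI)
  fix U \<phi> assume ch: "(U, \<phi>) \<in> atlas"
  let ?S = "\<phi> ` (U \<inter> W)" and ?f = "\<lambda>y. f (inv_into U \<phi> y)"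
  have S: "open ?S" by (rule chart_domain_image_open[OF ch assms(1)])
  obtain c where c: "smooth_map_on (U \<inter> W) c"
    "\<And>x. x \<in> U \<inter> W \<Longrightarrow> X x = coordinate_vector (U, \<phi>) x (c x)"
    using assms(2) ch unfolding smooth_vector_field_on_def by fast
  have "smooth_on ?S ?f"
    using smooth_map_onD[OF smooth_map_on_subset ch, of UNIV f W] assms(3)
    by (simp add: Cinf_iff_smooth_map_on)
  moreover have "smooth_on ?S (\<lambda>y. c (inv_into U \<phi> y))"
    using smooth_map_onD[OF c(1) ch] by simp
  ultimately have "smooth_on ?S (\<lambda>y. frechet_derivative ?f (at y) (c (inv_into U \<phi> y)))"
    by (rule smooth_on_frechet_derivative_along[OF finite_dimensional_model S])
  then show "smooth_on ?S (\<lambda>y. X (inv_into U \<phi> y) f)"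
    by (rule smooth_on_cong[OF S, rotated])
       (use c(2) chart_inv[OF ch] assms(3) in \<open>auto simp: coordinate_vector_def\<close>)
qed

lemma tangent_space_add:
    "X \<in> tangent_space x \<Longrightarrow> f \<in> Cinf \<Longrightarrow> h \<in> Cinf \<Longrightarrow> X (\<lambda>y. f y + h y) = X f + X h"
  and tangent_space_scale: "X \<in> tangent_space x \<Longrightarrow> f \<in> Cinf \<Longrightarrow> X (\<lambda>y. a * f y) = a * X f"
  and tangent_space_mult:
    "X \<in> tangent_space x \<Longrightarrow> f \<in> Cinf \<Longrightarrow> h \<in> Cinf \<Longrightarrow> X (\<lambda>y. f y * h y) = f x * X h + h x * X f"
  unfolding tangent_space_def by blast+

end

section \<open>Smooth solutions of linear systems\<close>

text \<open>Matrices are given by their entries as functions of indices, because in the applications the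
  entries vary smoothly over the manifold.\<close>

lemma sum_adjugate_eq_det:
  fixes A :: "nat \<Rightarrow> nat \<Rightarrow> real" and n :: nat
  defines "M \<equiv> Matrix.mat n n (\<lambda>(i, j). A i j)"
  assumes "i < n" "l < n"
  shows "(\<Sum>j<n. A i j * adj_mat M $$ (j, l)) = (if i = l then Determinant.det M else 0)"
proof -
  have M: "M \<in> carrier_mat n n" by (simp add: M_def)
  have "(M * adj_mat M) $$ (i, l) = (Determinant.det M \<cdot>\<^sub>m 1\<^sub>m n) $$ (i, l)"
    using adj_mat(2)[OF M] by simp
  moreover have "(M * adj_mat M) $$ (i, l) = (\<Sum>j<n. A i j * adj_mat M $$ (j, l))"
    using assms(2,3) adj_mat(1)[OF M] M
    by (simp add: times_mat_def scalar_prod_def M_def lessThan_atLeast0)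
  ultimately show ?thesis
    using assms(2,3) by simp
qed

lemma det_nonzero_if_injective:
  fixes A :: "nat \<Rightarrow> nat \<Rightarrow> real"
  assumes inj: "\<And>c j. (\<And>i. i < n \<Longrightarrow> (\<Sum>j<n. A i j * c j) = 0) \<Longrightarrow> j < n \<Longrightarrow> c j = 0"
  shows "Determinant.det (Matrix.mat n n (\<lambda>(i, j). A i j)) \<noteq> 0"
proof
  let ?M = "Matrix.mat n n (\<lambda>(i, j). A i j)"
  assume "Determinant.det ?M = 0"
  then obtain v where v: "v \<in> carrier_vec n" "v \<noteq> 0\<^sub>v n" "?M *\<^sub>v v = 0\<^sub>v n"
    using det_0_iff_vec_prod_zero_field[of ?M n] by auto
  have "(\<Sum>j<n. A i j * vec_index v j) = 0" if "i < n" for i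
  proof -
    have "vec_index (?M *\<^sub>v v) i = (\<Sum>j<n. A i j * vec_index v j)"
      using v(1) that by (simp add: scalar_prod_def lessThan_atLeast0)
    then show ?thesis using v(3) that by simp
  qed
  then have "vec_index v j = 0" if "j < n" for j
    using inj[of "vec_index v" j] that by simp
  then have "v = 0\<^sub>v n"
    using v(1) by (intro eq_vecI) auto
  then show False using v(2) by simp
qed

lemma permutes_nth: "p permutes {0..<n} \<Longrightarrow> i < n \<Longrightarrow> p i < (n::nat)"
  using permutes_in_image[of p "{0..<n}" i] by simp

context smooth_manifold
begin

lemma smooth_map_on_det:
  assumes "open W" "\<And>i j. i < n \<Longrightarrow> j < n \<Longrightarrow> smooth_map_on W (\<lambda>x. A x i j :: real)"
  shows "smooth_map_on W (\<lambda>x. Determinant.det (Matrix.mat n n (\<lambda>(i, j). A x i j)))"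
proof -
  have "Determinant.det (Matrix.mat n n (\<lambda>(i, j). A x i j)) =
      (\<Sum>p | p permutes {0..<n}. of_int (sign p) * (\<Prod>i = 0..<n. A x i (p i)))" for x
    by (subst det_def'[of _ n]) (auto intro!: sum.cong prod.cong dest!: permutes_nth)
  moreover have "smooth_map_on W
      (\<lambda>x. \<Sum>p | p permutes {0..<n}. of_int (sign p) * (\<Prod>i = 0..<n. A x i (p i)))"
    by (intro smooth_map_on_sum smooth_map_on_mult smooth_map_on_prod assms smooth_map_on_const)
       (auto dest: permutes_nth)
  ultimately show ?thesis by simp
qed

lemma smooth_map_on_adjugate:
  assumes "open W" "\<And>i j. i < n \<Longrightarrow> j < n \<Longrightarrow> smooth_map_on W (\<lambda>x. A x i j :: real)"
    and "i < n" "j < n"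
  shows "smooth_map_on W (\<lambda>x. adj_mat (Matrix.mat n n (\<lambda>(i, j). A x i j)) $$ (i, j))"
proof -
  let ?a = "\<lambda>x i' j'. A x (if i' < j then i' else Suc i') (if j' < i then j' else Suc j')"
  have minor: "mat_delete (Matrix.mat n n (\<lambda>(i, j). A x i j)) j i
      = Matrix.mat (n - 1) (n - 1) (\<lambda>(i', j'). ?a x i' j')" for x
    by (rule eq_matI) (auto simp: mat_delete_def)
  have "adj_mat (Matrix.mat n n (\<lambda>(i, j). A x i j)) $$ (i, j)
      = (- 1) ^ (j + i) * Determinant.det (Matrix.mat (n - 1) (n - 1) (\<lambda>(i', j'). ?a x i' j'))" for x
    using assms(3,4) by (simp add: adj_mat_def cofactor_def minor)
  moreover have "smooth_map_on W
      (\<lambda>x. (- 1) ^ (j + i) * Determinant.det (Matrix.mat (n - 1) (n - 1) (\<lambda>(i', j'). ?a x i' j')))"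
    by (intro smooth_map_on_mult smooth_map_on_det smooth_map_on_const assms(1,2)) auto
  ultimately show ?thesis by simp
qed

text \<open>Cramer's rule expresses the solution of an invertible system rationally in its coefficients.\<close>

lemma smooth_linear_system:
  fixes A :: "nat \<Rightarrow> nat \<Rightarrow> 'm \<Rightarrow> real" and r :: "nat \<Rightarrow> 'm \<Rightarrow> real"
  assumes W: "open W"
    and A: "\<And>i j. i < n \<Longrightarrow> j < n \<Longrightarrow> smooth_map_on W (A i j)"
    and r: "\<And>i. i < n \<Longrightarrow> smooth_map_on W (r i)"
    and inj: "\<And>x c j. x \<in> W \<Longrightarrow> (\<And>i. i < n \<Longrightarrow> (\<Sum>j<n. A i j x * c j) = 0) \<Longrightarrow> j < n \<Longrightarrow> c j = 0"
  obtains c where "\<And>j. j < n \<Longrightarrow> smooth_map_on W (c j)"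
    and "\<And>x i. x \<in> W \<Longrightarrow> i < n \<Longrightarrow> (\<Sum>j<n. A i j x * c j x) = r i x"
proof
  let ?M = "\<lambda>x. Matrix.mat n n (\<lambda>(i, j). A i j x)"
  let ?c = "\<lambda>j x. inverse (Determinant.det (?M x)) * (\<Sum>l<n. adj_mat (?M x) $$ (j, l) * r l x)"
  have det: "Determinant.det (?M x) \<noteq> 0" if "x \<in> W" for x
    using inj[OF that] by (rule det_nonzero_if_injective)
  show "smooth_map_on W (?c j)" if "j < n" for j
    using that det
    by (intro smooth_map_on_mult smooth_map_on_inverse smooth_map_on_det smooth_map_on_sum
        smooth_map_on_adjugate W A r) auto
  show "(\<Sum>j<n. A i j x * ?c j x) = r i x" if "x \<in> W" "i < n" for x i
  proof -
    have "(\<Sum>j<n. A i j x * ?c j x)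
        = (\<Sum>j<n. \<Sum>l<n. inverse (Determinant.det (?M x)) * r l x * (A i j x * adj_mat (?M x) $$ (j, l)))"
      by (simp add: sum_distrib_left mult_ac)
    also have "\<dots> = (\<Sum>l<n. inverse (Determinant.det (?M x)) * r l x * (\<Sum>j<n. A i j x * adj_mat (?M x) $$ (j, l)))"
      by (subst sum.swap) (simp add: sum_distrib_left)
    also have "\<dots> = (\<Sum>l<n. if i = l then r l x else 0)"
      by (intro sum.cong refl)
         (use det[OF that(1)] sum_adjugate_eq_det[where A = "\<lambda>i j. A i j x" and n = n] that(2) in auto)
    also have "\<dots> = r i x" using that(2) by simp
    finally show ?thesis .
  qed
qed

end

section \<open>Sections of a vector bundle\<close>

context vector_bundle
begin

lemma frame_at: obtains U b where "(U, b) \<in> frames" "x \<in> U"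
proof -
  have "x \<in> (\<Union>(U, b)\<in>frames. U)" using frames_cover by simp
  then show ?thesis using that by auto
qed

lemma frame_in_fibre:
  assumes "(U, b) \<in> frames" "x \<in> U" "i < k"
  shows "b i x \<in> E x"
proof -
  have "b i x \<in> span ((\<lambda>i. b i x) ` {..<k})"
    using assms(3) by (intro span_base) simp
  then show ?thesis using frame_basis[OF assms(1,2)] by simp
qed

lemma frame_combination_in_fibre:
  "(U, b) \<in> frames \<Longrightarrow> x \<in> U \<Longrightarrow> (\<Sum>i<k. c i *\<^sub>R b i x) \<in> E x"
  by (intro subspace_sum subspace_scale fibre_subspace) (simp add: frame_in_fibre)

lemma frame_expansion:
  assumes "(U, b) \<in> frames" "x \<in> U" "w \<in> E x"
  obtains c where "w = (\<Sum>i<k. c i *\<^sub>R b i x)"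
proof -
  let ?B = "(\<lambda>i. b i x) ` {..<k}"
  have "w \<in> span ?B" and inj: "inj_on (\<lambda>i. b i x) {..<k}"
    using frame_basis[OF assms(1,2)] assms(3) by auto
  then obtain u where "w = (\<Sum>v\<in>?B. u v *\<^sub>R v)"
    by (auto simp: span_finite)
  then have "w = (\<Sum>i<k. u (b i x) *\<^sub>R b i x)"
    by (simp add: sum.reindex[OF inj])
  then show ?thesis by (rule that)
qed

lemma frame_independent:
  assumes "(U, b) \<in> frames" "x \<in> U" "(\<Sum>i<k. c i *\<^sub>R b i x) = 0" "j < k"
  shows "c j = 0"
proof -
  let ?B = "(\<lambda>i. b i x) ` {..<k}"
  have inj: "inj_on (\<lambda>i. b i x) {..<k}" and ind: "independent ?B"
    using frame_basis[OF assms(1,2)] by auto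
  let ?u = "\<lambda>v. c (the_inv_into {..<k} (\<lambda>i. b i x) v)"
  have "(\<Sum>v\<in>?B. ?u v *\<^sub>R v) = (\<Sum>i<k. c i *\<^sub>R b i x)"
    by (simp add: sum.reindex[OF inj] the_inv_into_f_f[OF inj])
  then have "?u (b j x) = 0"
    using independentD[OF ind, of ?B ?u "b j x"] assms(3,4) by simp
  then show ?thesis
    using the_inv_into_f_f[OF inj] assms(4) by simp
qed

lemma sectionsI:
  assumes "\<And>x. s x \<in> E x"
    and "\<And>U b. (U, b) \<in> frames \<Longrightarrow> \<exists>c :: nat \<Rightarrow> 'm \<Rightarrow> real.
      (\<forall>i<k. smooth_map_on U (c i)) \<and> (\<forall>x\<in>U. s x = (\<Sum>i<k. c i x *\<^sub>R b i x))"
  shows "s \<in> sections"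
  unfolding sections_def using assms by blast

lemma section_in_fibre: "s \<in> sections \<Longrightarrow> s x \<in> E x"
  by (simp add: sections_def)

lemma section_coordinates:
  assumes "s \<in> sections" "(U, b) \<in> frames"
  obtains c :: "nat \<Rightarrow> 'm \<Rightarrow> real"
  where "\<And>i. i < k \<Longrightarrow> smooth_map_on U (c i)" "\<And>x. x \<in> U \<Longrightarrow> s x = (\<Sum>i<k. c i x *\<^sub>R b i x)"
proof -
  have "\<exists>c :: nat \<Rightarrow> 'm \<Rightarrow> real.
        (\<forall>i<k. smooth_map_on U (c i)) \<and> (\<forall>x\<in>U. s x = (\<Sum>i<k. c i x *\<^sub>R b i x))"
    using assms unfolding sections_def by blast
  then show ?thesis using that by blast
qed

lemma sections_add:
  assumes "s \<in> sections" "t \<in> sections"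
  shows "(\<lambda>x. s x + t x) \<in> sections"
proof (rule sectionsI)
  show "s x + t x \<in> E x" for x
    using assms by (simp add: section_in_fibre subspace_add fibre_subspace)
next
  fix U b assume fr: "(U, b) \<in> frames"
  obtain c where c: "\<And>i. i < k \<Longrightarrow> smooth_map_on U (c i)" "\<And>x. x \<in> U \<Longrightarrow> s x = (\<Sum>i<k. c i x *\<^sub>R b i x)"
    using section_coordinates[OF assms(1) fr] by blast
  obtain d where d: "\<And>i. i < k \<Longrightarrow> smooth_map_on U (d i)" "\<And>x. x \<in> U \<Longrightarrow> t x = (\<Sum>i<k. d i x *\<^sub>R b i x)"
    using section_coordinates[OF assms(2) fr] by blast
  show "\<exists>c. (\<forall>i<k. smooth_map_on U (c i)) \<and> (\<forall>x\<in>U. s x + t x = (\<Sum>i<k. c i x *\<^sub>R b i x))"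
    using c d frame_open[OF fr]
    by (intro exI[of _ "\<lambda>i x. c i x + d i x"])
       (simp add: smooth_map_on_add scaleR_left_distrib sum.distrib)
qed

lemma sections_smult:
  assumes "f \<in> Cinf" "s \<in> sections"
  shows "(\<lambda>x. f x *\<^sub>R s x) \<in> sections"
proof (rule sectionsI)
  show "f x *\<^sub>R s x \<in> E x" for x
    using assms by (simp add: section_in_fibre subspace_scale fibre_subspace)
next
  fix U b assume fr: "(U, b) \<in> frames"
  obtain c where c: "\<And>i. i < k \<Longrightarrow> smooth_map_on U (c i)" "\<And>x. x \<in> U \<Longrightarrow> s x = (\<Sum>i<k. c i x *\<^sub>R b i x)"
    using section_coordinates[OF assms(2) fr] by blast
  have "smooth_map_on U f"
    using assms(1) smooth_map_on_subset[of UNIV f U] by (simp add: Cinf_iff_smooth_map_on)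
  then show "\<exists>c. (\<forall>i<k. smooth_map_on U (c i)) \<and> (\<forall>x\<in>U. f x *\<^sub>R s x = (\<Sum>i<k. c i x *\<^sub>R b i x))"
    using c frame_open[OF fr]
    by (intro exI[of _ "\<lambda>i x. f x * c i x"]) (simp add: smooth_map_on_mult scaleR_sum_right)
qed

lemma sections_scale: "s \<in> sections \<Longrightarrow> (\<lambda>x. (a::real) *\<^sub>R s x) \<in> sections"
  by (rule sections_smult[OF Cinf_const])

lemma sections_diff: "s \<in> sections \<Longrightarrow> t \<in> sections \<Longrightarrow> (\<lambda>x. s x - t x) \<in> sections"
  using sections_add[of s "\<lambda>x. (- 1) *\<^sub>R t x"] sections_scale[of t "- 1"] by simp

text \<open>A combination of frame vectors with constant coefficients, cut off by a bump function.\<close>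

lemma section_through:
  assumes w: "w \<in> E x"
  obtains e where "e \<in> sections" "e x = w"
proof -
  obtain U b where fr: "(U, b) \<in> frames" "x \<in> U" by (rule frame_at)
  have openU: "open U" by (rule frame_open[OF fr(1)])
  obtain c where c: "w = (\<Sum>i<k. c i *\<^sub>R b i x)"
    using frame_expansion[OF fr w] by blast
  obtain \<eta> K where \<eta>: "\<eta> \<in> Cinf" "\<eta> x = 1" "closed K" "K \<subseteq> U" "\<And>y. y \<notin> K \<Longrightarrow> \<eta> y = 0"
    using bump_function[OF openU fr(2)] by blast
  define e where "e y = (if y \<in> U then \<eta> y *\<^sub>R (\<Sum>i<k. c i *\<^sub>R b i y) else 0)" for y
  have "e \<in> sections"
  proof (rule sectionsI)
    show "e y \<in> E y" for y
      using frame_combination_in_fibre[OF fr(1)] fibre_subspace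
      by (simp add: e_def subspace_scale subspace_0)
  next
    fix V b' assume fr': "(V, b') \<in> frames"
    have openV: "open V" by (rule frame_open[OF fr'])
    obtain a where a: "\<And>i j. i < k \<Longrightarrow> j < k \<Longrightarrow> smooth_map_on (V \<inter> U) (a i j)"
      "\<And>j y. j < k \<Longrightarrow> y \<in> V \<inter> U \<Longrightarrow> b j y = (\<Sum>i<k. a i j y *\<^sub>R b' i y)"
      using frames_compatible[OF fr' fr(1)] by blast
    define d where "d i y = (if y \<in> U then \<eta> y * (\<Sum>j<k. c j * a i j y) else 0)" for i y
    have "smooth_map_on V (d i)" if "i < k" for i
    proof (rule smooth_map_on_local)
      have openVU: "open (V \<inter> U)" using openU openV by blast
      have "smooth_map_on (V \<inter> U) \<eta>"
        using \<eta>(1) smooth_map_on_subset[of UNIV \<eta>] by (simp add: Cinf_iff_smooth_map_on)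
      then have "smooth_map_on (V \<inter> U) (\<lambda>y. \<eta> y * (\<Sum>j<k. c j * a i j y))"
        using that
        by (intro smooth_map_on_mult smooth_map_on_sum a(1) openVU smooth_map_on_const) auto
      then have 1: "smooth_map_on (V \<inter> U) (d i)"
        by (rule smooth_map_on_cong[OF openVU]) (simp add: d_def)
      have 2: "smooth_map_on (- K) (d i)"
        by (rule smooth_map_on_cong[OF _ smooth_map_on_const[of _ 0]])
           (use \<eta>(3,5) in \<open>auto simp: d_def open_Compl\<close>)
      fix y assume "y \<in> V"
      show "\<exists>T. open T \<and> y \<in> T \<and> smooth_map_on T (d i)"
      proof (cases "y \<in> U")
        case True
        then show ?thesis using 1 openVU \<open>y \<in> V\<close> by blast
      next
        case False
        then show ?thesis using 2 \<eta>(3,4) by (intro exI[of _ "- K"]) (auto simp: open_Compl)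
      qed
    qed
    moreover have "e y = (\<Sum>i<k. d i y *\<^sub>R b' i y)" if "y \<in> V" for y
    proof (cases "y \<in> U")
      case True
      have "(\<Sum>j<k. c j *\<^sub>R b j y) = (\<Sum>j<k. \<Sum>i<k. (c j * a i j y) *\<^sub>R b' i y)"
        using a(2) that True by (simp add: scaleR_sum_right)
      also have "\<dots> = (\<Sum>i<k. (\<Sum>j<k. c j * a i j y) *\<^sub>R b' i y)"
        by (subst sum.swap) (simp add: scaleR_sum_left)
      finally show ?thesis
        using True by (simp add: e_def d_def scaleR_sum_right)
    qed (simp add: e_def d_def)
    ultimately show "\<exists>d. (\<forall>i<k. smooth_map_on V (d i)) \<and> (\<forall>y\<in>V. e y = (\<Sum>i<k. d i y *\<^sub>R b' i y))"
      by blast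
  qed
  moreover have "e x = w"
    using fr(2) \<eta>(2) c by (simp add: e_def)
  ultimately show ?thesis using that by blast
qed

end

section \<open>The pairing, the anchor and the operator \<open>\<D>\<close>\<close>

context anchored_metric_bundle
begin

lemma form_zero_left: "w \<in> E x \<Longrightarrow> g x 0 w = 0"
  using form_scale[of 0 x w 0] subspace_0[OF fibre_subspace] by simp

lemma form_sum_left:
  assumes "\<And>i. i \<in> I \<Longrightarrow> u i \<in> E x" "w \<in> E x"
  shows "g x (\<Sum>i\<in>I. a i *\<^sub>R u i) w = (\<Sum>i\<in>I. a i * g x (u i) w)"
  using assms(1)
proof (induction I rule: infinite_finite_induct)
  case (insert i I)
  then have "a i *\<^sub>R u i \<in> E x" "(\<Sum>i\<in>I. a i *\<^sub>R u i) \<in> E x"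
    by (auto intro!: subspace_sum subspace_scale fibre_subspace)
  then show ?case
    using insert assms(2) by (simp add: form_add form_scale)
qed (simp_all add: form_zero_left assms(2))

lemma form_sum_right:
  assumes "\<And>i. i \<in> I \<Longrightarrow> u i \<in> E x" "w \<in> E x"
  shows "g x w (\<Sum>i\<in>I. a i *\<^sub>R u i) = (\<Sum>i\<in>I. a i * g x w (u i))"
proof -
  have "(\<Sum>i\<in>I. a i *\<^sub>R u i) \<in> E x"
    using assms(1) by (intro subspace_sum subspace_scale fibre_subspace)
  then show ?thesis
    using form_sum_left[OF assms] assms by (simp add: form_sym[of w])
qed

lemma anchor_sum:
  assumes "\<And>i. i \<in> I \<Longrightarrow> u i \<in> E x"
  shows "\<rho> x (\<Sum>i\<in>I. a i *\<^sub>R u i) f = (\<Sum>i\<in>I. a i * \<rho> x (u i) f)"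
  using assms
proof (induction I rule: infinite_finite_induct)
  case (insert i I)
  then have "a i *\<^sub>R u i \<in> E x" "(\<Sum>i\<in>I. a i *\<^sub>R u i) \<in> E x"
    by (auto intro!: subspace_sum subspace_scale fibre_subspace)
  then show ?case
    using insert by (simp add: anchor_add anchor_scale)
qed (use anchor_scale[of 0 x 0] subspace_0[OF fibre_subspace] in simp_all)

lemma pairing_Cinf:
  assumes "e \<in> sections" "h \<in> sections"
  shows "pairing e h \<in> Cinf"
  unfolding Cinf_iff_smooth_map_on
proof (rule smooth_map_on_local)
  fix x
  obtain U b where fr: "(U, b) \<in> frames" "x \<in> U" by (rule frame_at)
  have U: "open U" by (rule frame_open[OF fr(1)])
  obtain c where c: "\<And>i. i < k \<Longrightarrow> smooth_map_on U (c i)" "\<And>x. x \<in> U \<Longrightarrow> e x = (\<Sum>i<k. c i x *\<^sub>R b i x)"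
    using section_coordinates[OF assms(1) fr(1)] by blast
  obtain d where d: "\<And>i. i < k \<Longrightarrow> smooth_map_on U (d i)" "\<And>x. x \<in> U \<Longrightarrow> h x = (\<Sum>i<k. d i x *\<^sub>R b i x)"
    using section_coordinates[OF assms(2) fr(1)] by blast
  have "smooth_map_on U (\<lambda>y. \<Sum>i<k. c i y * (\<Sum>j<k. d j y * g y (b i y) (b j y)))"
    using form_smooth[OF fr(1)] c(1) d(1)
    by (intro smooth_map_on_sum smooth_map_on_mult U) auto
  then have "smooth_map_on U (pairing e h)"
  proof (rule smooth_map_on_cong[OF U])
    fix y assume y: "y \<in> U"
    have "pairing e h y = (\<Sum>i<k. c i y * g y (b i y) (h y))"
      unfolding pairing_def c(2)[OF y]
      using frame_in_fibre[OF fr(1) y] section_in_fibre[OF assms(2), of y] by (intro form_sum_left) auto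
    also have "\<dots> = (\<Sum>i<k. c i y * (\<Sum>j<k. d j y * g y (b i y) (b j y)))"
      unfolding d(2)[OF y]
      using frame_in_fibre[OF fr(1) y] by (intro sum.cong arg_cong2[of _ _ _ _ "(*)"] form_sum_right) auto
    finally show "(\<Sum>i<k. c i y * (\<Sum>j<k. d j y * g y (b i y) (b j y))) = pairing e h y" ..
  qed
  then show "\<exists>T. open T \<and> x \<in> T \<and> smooth_map_on T (pairing e h)"
    using U fr(2) by blast
qed

lemma anchor_deriv_Cinf:
  assumes "e \<in> sections" "f \<in> Cinf"
  shows "anchor_deriv e f \<in> Cinf"
  unfolding Cinf_iff_smooth_map_on
proof (rule smooth_map_on_local)
  fix x
  obtain U b where fr: "(U, b) \<in> frames" "x \<in> U" by (rule frame_at)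
  have U: "open U" by (rule frame_open[OF fr(1)])
  obtain c where c: "\<And>i. i < k \<Longrightarrow> smooth_map_on U (c i)" "\<And>x. x \<in> U \<Longrightarrow> e x = (\<Sum>i<k. c i x *\<^sub>R b i x)"
    using section_coordinates[OF assms(1) fr(1)] by blast
  have "smooth_map_on U (\<lambda>y. \<Sum>i<k. c i y * \<rho> y (b i y) f)"
    using smooth_vector_field_derivative[OF U anchor_smooth[OF fr(1)] assms(2)] c(1)
    by (intro smooth_map_on_sum smooth_map_on_mult U) auto
  moreover have "anchor_deriv e f y = (\<Sum>i<k. c i y * \<rho> y (b i y) f)" if y: "y \<in> U" for y
    unfolding anchor_deriv_def anchor_def c(2)[OF y]
    using frame_in_fibre[OF fr(1) y] by (intro anchor_sum) auto
  ultimately have "smooth_map_on U (anchor_deriv e f)"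
    by (intro smooth_map_on_cong[OF U, of _ "anchor_deriv e f"]) auto
  then show "\<exists>T. open T \<and> x \<in> T \<and> smooth_map_on T (anchor_deriv e f)"
    using U fr(2) by blast
qed

lemma fibre_eqI:
  assumes "u \<in> E x" "v \<in> E x" "\<And>w. w \<in> E x \<Longrightarrow> g x u w = g x v w"
  shows "u = v"
proof -
  have "g x (u - v) w = 0" if "w \<in> E x" for w
    using form_add[of u x "(- 1) *\<^sub>R v" w] form_scale[of v x w "- 1"] assms that
      subspace_scale[OF fibre_subspace assms(2), of "- 1"] by simp
  then have "u - v = 0"
    using assms(1,2) by (intro form_nondegenerate[of _ x] subspace_diff[OF fibre_subspace]) auto
  then show ?thesis by simp
qed

lemma section_eqI:
  assumes "s \<in> sections" "t \<in> sections" "\<And>e x. e \<in> sections \<Longrightarrow> pairing s e x = pairing t e x"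
  shows "s = t"
proof
  fix x
  show "s x = t x"
  proof (rule fibre_eqI)
    fix w assume "w \<in> E x"
    then obtain e where "e \<in> sections" "e x = w" by (rule section_through)
    then show "g x (s x) w = g x (t x) w"
      using assms(3)[of e x] by (auto simp: pairing_def)
  qed (use assms section_in_fibre in auto)
qed

text \<open>Over a local frame the equation for \<open>\<D> f\<close> is the linear system given by the Gram matrix of the
  frame. Its smooth local solutions agree on overlaps, because nondegeneracy makes them unique at
  every point.\<close>

lemma exists_gradient:
  assumes f: "f \<in> Cinf"
  shows "\<exists>s\<in>sections. \<forall>e\<in>sections. pairing s e = anchor_deriv e f"
proof -
  let ?P = "\<lambda>x u. u \<in> E x \<and> (\<forall>w\<in>E x. g x u w = \<rho> x w f)"
  have local: "\<exists>c. (\<forall>i<k. smooth_map_on U (c i)) \<and> (\<forall>x\<in>U. ?P x (\<Sum>i<k. c i x *\<^sub>R b i x))"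
    if fr: "(U, b) \<in> frames" for U b
  proof -
    have U: "open U" by (rule frame_open[OF fr])
    have inE: "\<And>x i. x \<in> U \<Longrightarrow> i < k \<Longrightarrow> b i x \<in> E x" by (rule frame_in_fibre[OF fr])
    have comb: "g x (\<Sum>j<k. c j *\<^sub>R b j x) (b i x) = (\<Sum>j<k. g x (b i x) (b j x) * c j)"
      if "x \<in> U" "i < k" for x i c
    proof -
      have "g x (\<Sum>j<k. c j *\<^sub>R b j x) (b i x) = (\<Sum>j<k. c j * g x (b j x) (b i x))"
        using inE that by (intro form_sum_left) auto
      also have "\<dots> = (\<Sum>j<k. g x (b i x) (b j x) * c j)"
        using inE that by (intro sum.cong) (auto simp: form_sym[of "b i x"])
      finally show ?thesis .
    qed
    have expand: "g x u w = \<rho> x w f" if x: "x \<in> U" and u: "u \<in> E x" and w: "w \<in> E x"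
      and test: "\<And>i. i < k \<Longrightarrow> g x u (b i x) = \<rho> x (b i x) f" for x u w
    proof -
      obtain d where w: "w = (\<Sum>i<k. d i *\<^sub>R b i x)" using frame_expansion[OF fr x w] .
      have "g x u w = (\<Sum>i<k. d i * g x u (b i x))"
        unfolding w using inE[OF x] u by (intro form_sum_right) auto
      also have "\<dots> = (\<Sum>i<k. d i * \<rho> x (b i x) f)"
        using test by simp
      also have "\<dots> = \<rho> x w f"
        unfolding w using inE[OF x] by (intro anchor_sum[symmetric]) auto
      finally show ?thesis .
    qed
    obtain c where c: "\<And>j. j < k \<Longrightarrow> smooth_map_on U (c j)"
      "\<And>x i. x \<in> U \<Longrightarrow> i < k \<Longrightarrow> (\<Sum>j<k. g x (b i x) (b j x) * c j x) = \<rho> x (b i x) f"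
    proof (rule smooth_linear_system[OF U, of k "\<lambda>i j x. g x (b i x) (b j x)" "\<lambda>i x. \<rho> x (b i x) f"])
      show "c j = 0" if x: "x \<in> U" and "j < k"
        and sys: "\<And>i. i < k \<Longrightarrow> (\<Sum>j<k. g x (b i x) (b j x) * c j) = 0" for x c j
      proof (rule frame_independent[OF fr x _ \<open>j < k\<close>])
        let ?u = "\<Sum>j<k. c j *\<^sub>R b j x"
        have u: "?u \<in> E x" by (rule frame_combination_in_fibre[OF fr x])
        have "g x ?u w = 0" if w: "w \<in> E x" for w
        proof -
          obtain d where w: "w = (\<Sum>i<k. d i *\<^sub>R b i x)" using frame_expansion[OF fr x w] .
          have "g x ?u w = (\<Sum>i<k. d i * g x ?u (b i x))"
            unfolding w using inE[OF x] u by (intro form_sum_right) auto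
          also have "\<dots> = 0"
            using comb[OF x] sys by simp
          finally show ?thesis .
        qed
        then show "?u = 0" using form_nondegenerate[OF u] by blast
      qed
    qed (use form_smooth[OF fr] smooth_vector_field_derivative[OF U anchor_smooth[OF fr] f] in auto)
    have "?P x (\<Sum>j<k. c j x *\<^sub>R b j x)" if x: "x \<in> U" for x
      using expand[OF x frame_combination_in_fibre[OF fr x]] comb[OF x] c(2)[OF x]
        frame_combination_in_fibre[OF fr x] by auto
    then show ?thesis using c(1) by blast
  qed
  have unique: "u = v" if "?P x u" "?P x v" for x u v
    using that by (intro fibre_eqI[of u x v]) auto
  have "\<exists>u. ?P x u" for x
  proof -
    obtain U b where "(U, b) \<in> frames" "x \<in> U" by (rule frame_at)
    then show ?thesis using local by blast
  qed
  then obtain s where s: "\<And>x. ?P x (s x)" by metis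
  have "s \<in> sections"
  proof (rule sectionsI)
    fix U b assume "(U, b) \<in> frames"
    then obtain c where c: "\<forall>i<k. smooth_map_on U (c i)" "\<forall>x\<in>U. ?P x (\<Sum>i<k. c i x *\<^sub>R b i x)"
      using local by blast
    then have "\<forall>x\<in>U. s x = (\<Sum>i<k. c i x *\<^sub>R b i x)"
      using unique s by blast
    then show "\<exists>c. (\<forall>i<k. smooth_map_on U (c i)) \<and> (\<forall>x\<in>U. s x = (\<Sum>i<k. c i x *\<^sub>R b i x))"
      using c(1) by blast
  qed (use s in blast)
  moreover have "pairing s e = anchor_deriv e f" if "e \<in> sections" for e
    using s section_in_fibre[OF that] by (auto simp: pairing_def anchor_deriv_def anchor_def)
  ultimately show ?thesis by blast
qed

lemma D_characterization:
  assumes "f \<in> Cinf"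
  shows "\<D> f \<in> sections \<and> (\<forall>e\<in>sections. pairing (\<D> f) e = anchor_deriv e f)"
  unfolding \<D>_def
proof (rule theI'[where P = "\<lambda>s. s \<in> sections \<and> (\<forall>e\<in>sections. pairing s e = anchor_deriv e f)"])
  show "\<exists>!s. s \<in> sections \<and> (\<forall>e\<in>sections. pairing s e = anchor_deriv e f)"
    using exists_gradient[OF assms] section_eqI by (metis (no_types, lifting))
qed

lemma D_section: "f \<in> Cinf \<Longrightarrow> \<D> f \<in> sections"
  and pairing_D: "f \<in> Cinf \<Longrightarrow> e \<in> sections \<Longrightarrow> pairing (\<D> f) e = anchor_deriv e f"
  using D_characterization by auto

lemma pairing_add_left:
    "s \<in> sections \<Longrightarrow> t \<in> sections \<Longrightarrow> e \<in> sections \<Longrightarrow>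
      pairing (\<lambda>x. s x + t x) e y = pairing s e y + pairing t e y"
  and pairing_smult_left:
    "s \<in> sections \<Longrightarrow> e \<in> sections \<Longrightarrow> pairing (\<lambda>x. f x *\<^sub>R s x) e y = f y * pairing s e y"
  and pairing_commute: "s \<in> sections \<Longrightarrow> e \<in> sections \<Longrightarrow> pairing s e = pairing e s"
  by (auto simp: pairing_def section_in_fibre form_add form_scale form_sym)

lemma pairing_add_right:
    "s \<in> sections \<Longrightarrow> t \<in> sections \<Longrightarrow> e \<in> sections \<Longrightarrow>
      pairing e (\<lambda>x. s x + t x) y = pairing e s y + pairing e t y"
  by (simp add: pairing_commute[of e] sections_add pairing_add_left)

lemma pairing_smult_right:
    "f \<in> Cinf \<Longrightarrow> s \<in> sections \<Longrightarrow> e \<in> sections \<Longrightarrow> pairing e (\<lambda>x. f x *\<^sub>R s x) y = f y * pairing e s y"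
  by (simp add: pairing_commute[of e] sections_smult pairing_smult_left)

lemma anchor_deriv_add:
    "e \<in> sections \<Longrightarrow> f \<in> Cinf \<Longrightarrow> h \<in> Cinf \<Longrightarrow>
      anchor_deriv e (\<lambda>y. f y + h y) x = anchor_deriv e f x + anchor_deriv e h x"
  and anchor_deriv_scale:
    "e \<in> sections \<Longrightarrow> f \<in> Cinf \<Longrightarrow> anchor_deriv e (\<lambda>y. a * f y) x = a * anchor_deriv e f x"
  and anchor_deriv_mult:
    "e \<in> sections \<Longrightarrow> f \<in> Cinf \<Longrightarrow> h \<in> Cinf \<Longrightarrow>
      anchor_deriv e (\<lambda>y. f y * h y) x = f x * anchor_deriv e h x + h x * anchor_deriv e f x"
  unfolding anchor_deriv_def anchor_def
  using anchor_tangent[OF section_in_fibre, of e x]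
    tangent_space_add tangent_space_scale tangent_space_mult by simp_all

lemma D_add:
  assumes "f \<in> Cinf" "h \<in> Cinf"
  shows "\<D> (\<lambda>x. f x + h x) = (\<lambda>x. \<D> f x + \<D> h x)"
  by (rule section_eqI)
     (use assms in \<open>simp_all add: D_section Cinf_add sections_add pairing_add_left pairing_D anchor_deriv_add\<close>)

lemma D_scale:
  assumes "f \<in> Cinf"
  shows "\<D> (\<lambda>x. a * f x) = (\<lambda>x. a *\<^sub>R \<D> f x)"
  by (rule section_eqI)
     (use assms in \<open>simp_all add: D_section Cinf_scale sections_scale pairing_smult_left pairing_D anchor_deriv_scale\<close>)

lemma D_mult:
  assumes "f \<in> Cinf" "h \<in> Cinf"
  shows "\<D> (\<lambda>x. f x * h x) = (\<lambda>x. f x *\<^sub>R \<D> h x + h x *\<^sub>R \<D> f x)"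
  by (rule section_eqI)
     (use assms in \<open>simp_all add: D_section Cinf_mult sections_smult sections_add pairing_add_left
        pairing_smult_left pairing_D anchor_deriv_mult\<close>)

end

section \<open>Courant algebroids without the Jacobi identity\<close>

text \<open>A Courant algebroid in either convention gives this structure, and within it the two forms of
  the Jacobi identity can be compared before either of them is known.\<close>

locale pre_courant_algebroid = anchored_metric_bundle atlas E k frames g \<rho>
  for atlas :: "('m::{t2_space,second_countable_topology} set \<times> ('m \<Rightarrow> 'b::real_inner)) set"
    and E :: "'m \<Rightarrow> 'v::real_vector set"
    and k :: nat
    and frames :: "('m set \<times> (nat \<Rightarrow> 'm \<Rightarrow> 'v)) set"
    and g :: "'m \<Rightarrow> 'v \<Rightarrow> 'v \<Rightarrow> real"
    and \<rho> :: "'m \<Rightarrow> 'v \<Rightarrow> ('m \<Rightarrow> real) \<Rightarrow> real" +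
  fixes opr :: "('m \<Rightarrow> 'v) \<Rightarrow> ('m \<Rightarrow> 'v) \<Rightarrow> 'm \<Rightarrow> 'v"
  assumes opr_bilinear: "bilinear_operation opr"
    and opr_anchor: "e1 \<in> sections \<Longrightarrow> e2 \<in> sections \<Longrightarrow>
      anchor (opr e1 e2) = lie_bracket (anchor e1) (anchor e2)"
    and opr_leibniz: "e1 \<in> sections \<Longrightarrow> e2 \<in> sections \<Longrightarrow> f \<in> Cinf \<Longrightarrow>
      opr e1 (\<lambda>x. f x *\<^sub>R e2 x) = (\<lambda>x. f x *\<^sub>R opr e1 e2 x + anchor_deriv e1 f x *\<^sub>R e2 x)"
    and opr_square: "e \<in> sections \<Longrightarrow> opr e e = (\<lambda>x. (1/2) *\<^sub>R \<D> (pairing e e) x)"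
    and opr_metric: "e \<in> sections \<Longrightarrow> h1 \<in> sections \<Longrightarrow> h2 \<in> sections \<Longrightarrow>
      anchor_deriv e (pairing h1 h2) = (\<lambda>x. pairing (opr e h1) h2 x + pairing h1 (opr e h2) x)"
begin

lemma opr_section: "a \<in> sections \<Longrightarrow> b \<in> sections \<Longrightarrow> opr a b \<in> sections"
  and opr_add_left: "a \<in> sections \<Longrightarrow> b \<in> sections \<Longrightarrow> c \<in> sections \<Longrightarrow>
    opr (\<lambda>x. a x + b x) c = (\<lambda>x. opr a c x + opr b c x)"
  and opr_add_right: "a \<in> sections \<Longrightarrow> b \<in> sections \<Longrightarrow> c \<in> sections \<Longrightarrow>
    opr c (\<lambda>x. a x + b x) = (\<lambda>x. opr c a x + opr c b x)"
  and opr_scale_left: "a \<in> sections \<Longrightarrow> b \<in> sections \<Longrightarrow>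
    opr (\<lambda>x. r *\<^sub>R a x) b = (\<lambda>x. r *\<^sub>R opr a b x)"
  and opr_scale_right: "a \<in> sections \<Longrightarrow> b \<in> sections \<Longrightarrow>
    opr b (\<lambda>x. r *\<^sub>R a x) = (\<lambda>x. r *\<^sub>R opr b a x)"
  using opr_bilinear unfolding bilinear_operation_def by blast+

lemma D_pairing_section: "a \<in> sections \<Longrightarrow> b \<in> sections \<Longrightarrow> \<D> (pairing a b) \<in> sections"
  by (simp add: D_section pairing_Cinf)

text \<open>Polarisation of the axiom on \<open>e \<circ> e\<close>.\<close>

lemma opr_symmetric_part:
  assumes a: "a \<in> sections" and b: "b \<in> sections"
  shows "opr a b x + opr b a x = \<D> (pairing a b) x"
proof -
  let ?s = "\<lambda>x. a x + b x"
  note [simp] = a b pairing_Cinf sections_add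
  have "pairing ?s ?s = (\<lambda>x. pairing a a x + 2 * pairing a b x + pairing b b x)"
    by (rule ext) (simp add: pairing_add_left pairing_add_right pairing_commute[of b a])
  then have "\<D> (pairing ?s ?s) = (\<lambda>x. \<D> (pairing a a) x + 2 *\<^sub>R \<D> (pairing a b) x + \<D> (pairing b b) x)"
    by (simp add: D_add D_scale Cinf_add Cinf_scale)
  moreover have "opr ?s ?s x = opr a a x + opr a b x + (opr b a x + opr b b x)"
    by (simp add: opr_add_left opr_add_right)
  ultimately have "opr a a x + opr a b x + (opr b a x + opr b b x)
      = (1/2) *\<^sub>R \<D> (pairing a a) x + \<D> (pairing a b) x + (1/2) *\<^sub>R \<D> (pairing b b) x"
    using opr_square[of ?s] by (simp add: scaleR_right_distrib)
  then show ?thesis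
    using opr_square[OF a] opr_square[OF b] by (simp add: algebra_simps)
qed

lemma anchor_deriv_opr:
  assumes "a \<in> sections" "b \<in> sections" "f \<in> Cinf"
  shows "anchor_deriv (opr a b) f x
    = anchor_deriv a (anchor_deriv b f) x - anchor_deriv b (anchor_deriv a f) x"
  using assms by (simp add: anchor_deriv_def opr_anchor lie_bracket_def)

text \<open>Differentiating \<open>\<langle>\<D>f, h\<rangle> = \<rho>(h)f\<close> along \<open>e\<close> produces the commutator of \<open>\<rho>(e)\<close> and \<open>\<rho>(h)\<close>, which
  is \<open>\<rho>(e \<circ> h)\<close>; what remains is \<open>\<rho>(h)\<rho>(e)f\<close>.\<close>

lemma opr_D_right:
  assumes "e \<in> sections" "f \<in> Cinf"
  shows "opr e (\<D> f) = \<D> (anchor_deriv e f)"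
proof (rule section_eqI)
  fix h x assume h: "h \<in> sections"
  note [simp] = assms h D_section anchor_deriv_Cinf opr_section
  have "anchor_deriv e (anchor_deriv h f) x = pairing (opr e (\<D> f)) h x + anchor_deriv (opr e h) f x"
    using fun_cong[OF opr_metric[of e "\<D> f" h], of x] by (simp add: pairing_D)
  then show "pairing (opr e (\<D> f)) h x = pairing (\<D> (anchor_deriv e f)) h x"
    by (simp add: anchor_deriv_opr pairing_D)
qed (simp_all add: assms D_section anchor_deriv_Cinf opr_section)

lemma opr_D_left:
  assumes "e \<in> sections" "f \<in> Cinf"
  shows "opr (\<D> f) e = (\<lambda>x. 0)"
proof
  fix x
  show "opr (\<D> f) e x = 0"
    using opr_symmetric_part[of "\<D> f" e x] assms by (simp add: D_section pairing_D opr_D_right)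
qed

text \<open>The anchor kills \<open>\<D> \<langle>a, b\<rangle>\<close>, because it sends the symmetric part of the operation to that of a
  Lie bracket. Replacing \<open>b\<close> by \<open>f b\<close> extends this to \<open>\<D> f\<close> wherever \<open>\<langle>a, b\<rangle> \<noteq> 0\<close>; by
  nondegeneracy \<open>a = \<D> f\<close> admits such a \<open>b\<close> at every point where \<open>\<D> f\<close> is not already zero.\<close>

lemma anchor_D_eq_zero:
  assumes f: "f \<in> Cinf"
  shows "anchor (\<D> f) x h = 0"
proof (cases "\<D> f x = 0")
  case True
  then show ?thesis
    using anchor_scale[of 0 x 0] subspace_0[OF fibre_subspace] by (simp add: anchor_def)
next
  case False
  let ?a = "\<D> f"
  have a: "?a \<in> sections" by (rule D_section[OF f])
  have kills: "\<rho> x (\<D> (pairing a b) x) h = 0" if "a \<in> sections" "b \<in> sections" for a b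
  proof -
    have "\<rho> x (\<D> (pairing a b) x) h = \<rho> x (opr a b x + opr b a x) h"
      by (simp add: opr_symmetric_part that)
    also have "\<dots> = anchor (opr a b) x h + anchor (opr b a) x h"
      by (simp add: anchor_def anchor_add section_in_fibre opr_section that)
    also have "\<dots> = 0"
      by (simp add: opr_anchor that lie_bracket_def)
    finally show ?thesis .
  qed
  obtain w where w: "w \<in> E x" "g x (?a x) w \<noteq> 0"
    using form_nondegenerate[of "?a x" x] section_in_fibre[OF a] False by blast
  obtain b where b: "b \<in> sections" "b x = w" using section_through[OF w(1)] .
  let ?p = "pairing ?a b"
  have p: "?p \<in> Cinf" by (rule pairing_Cinf[OF a b(1)])
  have "pairing ?a (\<lambda>x. f x *\<^sub>R b x) = (\<lambda>x. f x * ?p x)"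
    by (rule ext) (simp add: pairing_smult_right f a b(1))
  then have "0 = \<rho> x (f x *\<^sub>R \<D> ?p x + ?p x *\<^sub>R ?a x) h"
    using kills[OF a sections_smult[OF f b(1)]] by (simp add: D_mult f p)
  also have "\<dots> = f x * \<rho> x (\<D> ?p x) h + ?p x * \<rho> x (?a x) h"
    by (simp add: anchor_add anchor_scale section_in_fibre D_section f p
        subspace_scale[OF fibre_subspace])
  also have "\<dots> = ?p x * \<rho> x (?a x) h"
    using kills[OF a b(1)] by simp
  finally show ?thesis
    using w(2) b(2) by (simp add: anchor_def pairing_def)
qed

definition skew :: "('m \<Rightarrow> 'v) \<Rightarrow> ('m \<Rightarrow> 'v) \<Rightarrow> 'm \<Rightarrow> 'v" where
  "skew e1 e2 = (\<lambda>x. (1/2) *\<^sub>R (opr e1 e2 x - opr e2 e1 x))"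

lemma skew_section: "a \<in> sections \<Longrightarrow> b \<in> sections \<Longrightarrow> skew a b \<in> sections"
  unfolding skew_def by (intro sections_scale sections_diff opr_section)

lemma skew_eq:
  assumes "a \<in> sections" "b \<in> sections"
  shows "skew a b = (\<lambda>x. opr a b x + (- 1/2) *\<^sub>R \<D> (pairing a b) x)"
proof
  fix x
  have "skew a b x = (1/2) *\<^sub>R (opr a b x + opr a b x) - (1/2) *\<^sub>R (opr a b x + opr b a x)"
    unfolding skew_def by (simp add: algebra_simps)
  then show "skew a b x = opr a b x + (- 1/2) *\<^sub>R \<D> (pairing a b) x"
    by (simp add: opr_symmetric_part assms flip: scaleR_2)
qed

lemma opr_eq_skew:
  "a \<in> sections \<Longrightarrow> b \<in> sections \<Longrightarrow> opr a b = (\<lambda>x. skew a b x + (1/2) *\<^sub>R \<D> (pairing a b) x)"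
  by (rule ext) (simp add: skew_eq)

lemma skew_skew:
  assumes "a \<in> sections" "b \<in> sections" "c \<in> sections"
  shows "skew (skew a b) c x = opr (opr a b) c x - (1/2) *\<^sub>R \<D> (pairing (skew a b) c) x"
proof -
  note [simp] = assms opr_section D_pairing_section sections_scale skew_section pairing_Cinf
  have "opr (skew a b) c = (\<lambda>x. opr (opr a b) c x + (- 1/2) *\<^sub>R opr (\<D> (pairing a b)) c x)"
    by (simp only: skew_eq assms) (simp add: opr_add_left opr_scale_left del: scaleR_minus_left)
  then show ?thesis
    by (simp add: skew_eq[of "skew a b" c] opr_D_left)
qed

text \<open>Splitting \<open>\<circ>\<close> into its skew and symmetric parts and using invariance of the pairing, one finds
  that \<open>X = \<langle>a, b \<circ> c\<rangle> - \<langle>b, a \<circ> c\<rangle>\<close> satisfies \<open>X = 6T - X/2\<close>, where \<open>6T\<close> is the cyclic sum of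
  \<open>\<langle>[a, b], c\<rangle>\<close>.\<close>

lemma pairing_opr_diff:
  assumes a: "a \<in> sections" and b: "b \<in> sections" and c: "c \<in> sections"
  shows "pairing a (opr b c) x - pairing b (opr a c) x = 4 * bracket_triple skew a b c x"
proof -
  note [simp] = assms opr_section sections_scale skew_section pairing_Cinf D_section
  have split: "pairing (opr u v) w x = pairing (skew u v) w x + 1/2 * anchor_deriv w (pairing u v) x"
    if [simp]: "u \<in> sections" "v \<in> sections" "w \<in> sections" for u v w
  proof -
    have "pairing (opr u v) w x = pairing (\<lambda>x. skew u v x + (1/2) *\<^sub>R \<D> (pairing u v) x) w x"
      by (simp only: opr_eq_skew that)
    also have "\<dots> = pairing (skew u v) w x + pairing (\<lambda>x. (1/2) *\<^sub>R \<D> (pairing u v) x) w x"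
      by (rule pairing_add_left) simp_all
    also have "\<dots> = pairing (skew u v) w x + 1/2 * anchor_deriv w (pairing u v) x"
      using pairing_smult_left[of "\<D> (pairing u v)" w "\<lambda>_. 1/2"] by (simp add: pairing_D)
    finally show ?thesis .
  qed
  have skew_ac: "pairing (skew a c) b x = - pairing (skew c a) b x"
  proof -
    have "skew a c = (\<lambda>x. (- 1) *\<^sub>R skew c a x)"
      by (simp add: skew_def fun_eq_iff scaleR_minus_right[symmetric] del: scaleR_minus_right)
    then show ?thesis
      using pairing_smult_left[of "skew c a" b "\<lambda>_. - 1" x] by simp
  qed
  have "anchor_deriv a (pairing b c) x = pairing (opr a b) c x + pairing b (opr a c) x"
    and "anchor_deriv b (pairing a c) x = pairing (opr b a) c x + pairing a (opr b c) x"
    by (simp_all add: opr_metric)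
  moreover have "pairing (skew b a) c x = - pairing (skew a b) c x"
  proof -
    have "skew b a = (\<lambda>x. (- 1) *\<^sub>R skew a b x)"
      by (simp add: skew_def fun_eq_iff scaleR_minus_right[symmetric] del: scaleR_minus_right)
    then show ?thesis
      using pairing_smult_left[of "skew a b" c "\<lambda>_. - 1" x] by simp
  qed
  moreover have "pairing a (opr b c) x = pairing (opr b c) a x"
    and "pairing b (opr a c) x = pairing (opr a c) b x"
    and "anchor_deriv c (pairing b a) x = anchor_deriv c (pairing a b) x"
    by (simp_all only: pairing_commute[OF a opr_section[OF b c]]
        pairing_commute[OF b opr_section[OF a c]] pairing_commute[OF b a])
  ultimately show ?thesis
    using split[OF b c a] split[OF a c b] split[OF a b c] split[OF b a c] skew_ac
    unfolding bracket_triple_def by argo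
qed

text \<open>The key identity: rewriting every term of the Jacobiator of the skew bracket through \<open>\<circ>\<close> leaves
  the defect of the Leibniz form of the Jacobi identity and gradients of functions, and these
  gradients add up to \<open>\<D> T\<close> by the preceding lemma.\<close>

lemma jacobiator_skew:
  assumes a: "a \<in> sections" and b: "b \<in> sections" and c: "c \<in> sections"
  shows "jacobiator skew a b c x
    = \<D> (bracket_triple skew a b c) x - (opr a (opr b c) x - (opr (opr a b) c x + opr b (opr a c) x))"
proof -
  note [simp] = assms opr_section D_pairing_section sections_scale sections_diff skew_section pairing_Cinf
  let ?T = "bracket_triple skew a b c"
  let ?P = "\<lambda>u v w. pairing (skew u v) w"
  have six: "\<D> (?P a b c) x + \<D> (?P b c a) x + \<D> (?P c a b) x = 6 *\<^sub>R \<D> ?T x"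
  proof -
    have "(\<lambda>x. ?P a b c x + ?P b c a x + ?P c a b x) = (\<lambda>x. 6 * ?T x)"
      by (simp add: bracket_triple_def add_divide_distrib)
    moreover have "?T \<in> Cinf"
      unfolding bracket_triple_def by (intro Cinf_scale Cinf_add) simp_all
    ultimately show ?thesis
      using D_add[of "\<lambda>x. ?P a b c x + ?P b c a x" "?P c a b"] D_add[of "?P a b c" "?P b c a"]
        D_scale[of ?T 6] by (simp add: Cinf_add fun_eq_iff)
  qed
  have four: "\<D> (pairing a (opr b c)) x - \<D> (pairing b (opr a c)) x = 4 *\<^sub>R \<D> ?T x"
  proof -
    have "pairing a (opr b c) = (\<lambda>x. pairing b (opr a c) x + 4 * ?T x)"
      using pairing_opr_diff[OF a b c] by (auto simp: fun_eq_iff algebra_simps)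
    moreover have T: "?T \<in> Cinf"
      unfolding bracket_triple_def by (intro Cinf_scale Cinf_add) simp_all
    ultimately show ?thesis
      using D_add[of "pairing b (opr a c)" "\<lambda>x. 4 * ?T x"] D_scale[OF T, of 4]
      by (simp add: Cinf_scale)
  qed
  have bca: "opr (opr b c) a x = \<D> (pairing a (opr b c)) x - opr a (opr b c) x"
    using opr_symmetric_part[of a "opr b c" x] by (simp add: algebra_simps)
  have cab: "opr (opr c a) b x = opr b (opr a c) x - \<D> (pairing b (opr a c)) x"
  proof -
    have "opr c a = (\<lambda>x. \<D> (pairing a c) x + (- 1) *\<^sub>R opr a c x)"
      using opr_symmetric_part[of a c] by (auto simp: fun_eq_iff algebra_simps)
    then have "opr (opr c a) b = (\<lambda>x. opr (\<D> (pairing a c)) b x + (- 1) *\<^sub>R opr (opr a c) b x)"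
      by (simp only: opr_add_left opr_scale_left assms opr_section D_pairing_section sections_scale)
    then show ?thesis
      using opr_symmetric_part[of b "opr a c" x] by (simp add: opr_D_left algebra_simps)
  qed
  have "jacobiator skew a b c x = opr (opr a b) c x + opr (opr b c) a x + opr (opr c a) b x
      - (1/2) *\<^sub>R (\<D> (?P a b c) x + \<D> (?P b c a) x + \<D> (?P c a b) x)"
    by (simp add: jacobiator_def skew_skew scaleR_right_distrib)
  also have "\<dots> = opr (opr a b) c x + (opr b (opr a c) x - opr a (opr b c) x)
      + (\<D> (pairing a (opr b c)) x - \<D> (pairing b (opr a c)) x) - 3 *\<^sub>R \<D> ?T x"
    unfolding six bca cab by simp
  also have "\<dots> = \<D> ?T x - (opr a (opr b c) x - (opr (opr a b) c x + opr b (opr a c) x))"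
  proof -
    have "4 *\<^sub>R \<D> ?T x - 3 *\<^sub>R \<D> ?T x = \<D> ?T x"
      by (simp flip: scaleR_left_diff_distrib)
    then show ?thesis unfolding four by (simp add: algebra_simps)
  qed
  finally show ?thesis .
qed

end

section \<open>Equivalence of the two definitions\<close>

lemma (in skew_courant_algebroid) pre_courant_algebroid_symmetrized:
  "pre_courant_algebroid atlas E k frames g \<rho>
     (\<lambda>e1 e2 x. br e1 e2 x + (1/2) *\<^sub>R \<D> (pairing e1 e2) x)"
proof
  let ?opr = "\<lambda>e1 e2 x. br e1 e2 x + (1/2) *\<^sub>R \<D> (pairing e1 e2) x"
  have br_section: "br a b \<in> sections" if "a \<in> sections" "b \<in> sections" for a b
    using bracket_bilinear that by (simp add: bilinear_operation_def)
  note [simp] = br_section D_section pairing_Cinf sections_add sections_smult sections_scale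
  have br_bilinear:
    "br (\<lambda>x. a x + b x) c = (\<lambda>x. br a c x + br b c x)"
    "br c (\<lambda>x. a x + b x) = (\<lambda>x. br c a x + br c b x)"
    "br (\<lambda>x. r *\<^sub>R a x) c = (\<lambda>x. r *\<^sub>R br a c x)"
    "br c (\<lambda>x. r *\<^sub>R a x) = (\<lambda>x. r *\<^sub>R br c a x)"
    if "a \<in> sections" "b \<in> sections" "c \<in> sections" for a b c r
    using bracket_bilinear that unfolding bilinear_operation_def by blast+
  have D_pairing_bilinear:
    "\<D> (pairing (\<lambda>x. a x + b x) c) = (\<lambda>x. \<D> (pairing a c) x + \<D> (pairing b c) x)"
    "\<D> (pairing c (\<lambda>x. a x + b x)) = (\<lambda>x. \<D> (pairing c a) x + \<D> (pairing c b) x)"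
    "\<D> (pairing (\<lambda>x. r *\<^sub>R a x) c) = (\<lambda>x. r *\<^sub>R \<D> (pairing a c) x)"
    "\<D> (pairing c (\<lambda>x. r *\<^sub>R a x)) = (\<lambda>x. r *\<^sub>R \<D> (pairing c a) x)"
    if [simp]: "a \<in> sections" "b \<in> sections" "c \<in> sections" for a b c r
  proof -
    have "pairing (\<lambda>x. a x + b x) c = (\<lambda>x. pairing a c x + pairing b c x)"
      "pairing c (\<lambda>x. a x + b x) = (\<lambda>x. pairing c a x + pairing c b x)"
      "pairing (\<lambda>x. r *\<^sub>R a x) c = (\<lambda>x. r * pairing a c x)"
      "pairing c (\<lambda>x. r *\<^sub>R a x) = (\<lambda>x. r * pairing c a x)"
      by (simp_all add: fun_eq_iff pairing_add_left pairing_add_right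
          pairing_smult_left[where f = "\<lambda>_. r"] pairing_smult_right[where f = "\<lambda>_. r"] Cinf_const)
    then show "\<D> (pairing (\<lambda>x. a x + b x) c) = (\<lambda>x. \<D> (pairing a c) x + \<D> (pairing b c) x)"
      "\<D> (pairing c (\<lambda>x. a x + b x)) = (\<lambda>x. \<D> (pairing c a) x + \<D> (pairing c b) x)"
      "\<D> (pairing (\<lambda>x. r *\<^sub>R a x) c) = (\<lambda>x. r *\<^sub>R \<D> (pairing a c) x)"
      "\<D> (pairing c (\<lambda>x. r *\<^sub>R a x)) = (\<lambda>x. r *\<^sub>R \<D> (pairing c a) x)"
      by (simp_all add: D_add D_scale)
  qed
  show "bilinear_operation ?opr"
    unfolding bilinear_operation_def
    by (intro conjI ballI allI) (simp_all add: br_bilinear D_pairing_bilinear algebra_simps)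
  show "anchor (?opr e1 e2) = lie_bracket (anchor e1) (anchor e2)"
    if e: "e1 \<in> sections" "e2 \<in> sections" for e1 e2
  proof (intro ext)
    fix x h
    have "\<D> (pairing e1 e2) x \<in> E x" "br e1 e2 x \<in> E x"
      using e by (auto intro: section_in_fibre)
    then have "anchor (?opr e1 e2) x h = anchor (br e1 e2) x h + 1/2 * anchor (\<D> (pairing e1 e2)) x h"
      by (simp add: anchor_def anchor_add anchor_scale[of _ x "1/2"] subspace_scale[OF fibre_subspace])
    then show "anchor (?opr e1 e2) x h = lie_bracket (anchor e1) (anchor e2) x h"
      using e by (simp add: bracket_anchor anchor_D)
  qed
  show "?opr e1 (\<lambda>x. f x *\<^sub>R e2 x) = (\<lambda>x. f x *\<^sub>R ?opr e1 e2 x + anchor_deriv e1 f x *\<^sub>R e2 x)"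
    if e: "e1 \<in> sections" "e2 \<in> sections" "f \<in> Cinf" for e1 e2 f
  proof -
    have pair: "pairing e1 (\<lambda>x. f x *\<^sub>R e2 x) = (\<lambda>x. f x * pairing e1 e2 x)"
      using e by (simp add: fun_eq_iff pairing_smult_right)
    show ?thesis
      by (rule ext) (use e in \<open>simp add: pair bracket_leibniz D_mult algebra_simps\<close>)
  qed
  show "?opr e e = (\<lambda>x. (1/2) *\<^sub>R \<D> (pairing e e) x)" if "e \<in> sections" for e
  proof -
    have "br e e x = 0" for x
    proof -
      have "br e e x + br e e x = 0"
        using fun_cong[OF bracket_skew[OF that that], of x] by (metis add.right_inverse)
      then show ?thesis by (simp flip: scaleR_2)
    qed
    then show ?thesis by simp
  qed
qed (rule bracket_metric)

text \<open>The skew part of the symmetrised operation is the given bracket on sections, so that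
  \<open>jacobiator_skew\<close> is a statement about the given Jacobiator.\<close>

lemma (in skew_courant_algebroid) leibniz_courant_algebroid_symmetrized:
  "leibniz_courant_algebroid atlas E k frames g \<rho>
     (\<lambda>e1 e2 x. br e1 e2 x + (1/2) *\<^sub>R \<D> (pairing e1 e2) x)"
proof -
  let ?opr = "\<lambda>e1 e2 x. br e1 e2 x + (1/2) *\<^sub>R \<D> (pairing e1 e2) x"
  interpret C: pre_courant_algebroid atlas E k frames g \<rho> ?opr
    by (rule pre_courant_algebroid_symmetrized)
  have skew_eq_br: "C.skew a b = br a b" if "a \<in> sections" "b \<in> sections" for a b
    using that by (simp add: C.skew_eq fun_eq_iff)
  have br_section: "br a b \<in> sections" if "a \<in> sections" "b \<in> sections" for a b
    using C.skew_section[OF that] skew_eq_br[OF that] by simp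
  show ?thesis
  proof
    show "?opr e1 (?opr e2 e3) = (\<lambda>x. ?opr (?opr e1 e2) e3 x + ?opr e2 (?opr e1 e3) x)"
      if e: "e1 \<in> sections" "e2 \<in> sections" "e3 \<in> sections" for e1 e2 e3
    proof
      fix x
      have "jacobiator C.skew e1 e2 e3 = jacobiator br e1 e2 e3"
        "bracket_triple C.skew e1 e2 e3 = bracket_triple br e1 e2 e3"
        using e by (simp_all add: jacobiator_def bracket_triple_def skew_eq_br br_section)
      then show "?opr e1 (?opr e2 e3) x = ?opr (?opr e1 e2) e3 x + ?opr e2 (?opr e1 e3) x"
        using C.jacobiator_skew[OF e, of x] bracket_jacobi[OF e] by simp
    qed
  qed (fact C.opr_bilinear C.opr_anchor C.opr_leibniz C.opr_square C.opr_metric)+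
qed

lemma (in leibniz_courant_algebroid) skew_courant_algebroid_skew:
  "skew_courant_algebroid atlas E k frames g \<rho> (\<lambda>e1 e2 x. (1/2) *\<^sub>R (opr e1 e2 x - opr e2 e1 x))"
proof -
  interpret C: pre_courant_algebroid atlas E k frames g \<rho> opr
    by unfold_locales (fact opr_bilinear opr_anchor opr_leibniz opr_square opr_metric)+
  note [simp] = C.opr_section C.skew_section D_section pairing_Cinf sections_add sections_smult
    sections_scale C.D_pairing_section
  have "skew_courant_algebroid atlas E k frames g \<rho> C.skew"
  proof
    show "bilinear_operation C.skew"
      unfolding bilinear_operation_def
    proof (intro conjI ballI allI)
      fix a b c r assume [simp]: "a \<in> sections" "b \<in> sections" "c \<in> sections"
      show "C.skew (\<lambda>x. a x + b x) c = (\<lambda>x. C.skew a c x + C.skew b c x)"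
        "C.skew c (\<lambda>x. a x + b x) = (\<lambda>x. C.skew c a x + C.skew c b x)"
        by (simp_all add: C.skew_def C.opr_add_left C.opr_add_right algebra_simps)
    next
      fix a b r assume [simp]: "a \<in> sections" "b \<in> sections"
      show "C.skew a b \<in> sections" by simp
      show "C.skew (\<lambda>x. r *\<^sub>R a x) b = (\<lambda>x. r *\<^sub>R C.skew a b x)"
        "C.skew b (\<lambda>x. r *\<^sub>R a x) = (\<lambda>x. r *\<^sub>R C.skew b a x)"
        by (simp_all add: C.skew_def C.opr_scale_left C.opr_scale_right algebra_simps)
    qed
    show "C.skew e1 e2 = (\<lambda>x. - C.skew e2 e1 x)" for e1 e2
      by (simp add: C.skew_def fun_eq_iff scaleR_minus_right[symmetric] del: scaleR_minus_right)
    show "jacobiator C.skew e1 e2 e3 = \<D> (bracket_triple C.skew e1 e2 e3)"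
      if "e1 \<in> sections" "e2 \<in> sections" "e3 \<in> sections" for e1 e2 e3
      using C.jacobiator_skew[OF that] opr_jacobi[OF that] by (simp add: fun_eq_iff)
    show "anchor (C.skew e1 e2) = lie_bracket (anchor e1) (anchor e2)"
      if e: "e1 \<in> sections" "e2 \<in> sections" for e1 e2
    proof (intro ext)
      fix x h
      have "\<D> (pairing e1 e2) x \<in> E x" "opr e1 e2 x \<in> E x"
        using e by (auto intro: section_in_fibre)
      then have "anchor (C.skew e1 e2) x h
          = anchor (opr e1 e2) x h + (- 1/2) * anchor (\<D> (pairing e1 e2)) x h"
        using e by (simp only: C.skew_eq anchor_def anchor_add anchor_scale[of _ x "- 1/2"]
            subspace_scale[OF fibre_subspace])
      then show "anchor (C.skew e1 e2) x h = lie_bracket (anchor e1) (anchor e2) x h"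
        using e by (simp add: opr_anchor C.anchor_D_eq_zero)
    qed
    show "C.skew e1 (\<lambda>x. f x *\<^sub>R e2 x) =
        (\<lambda>x. f x *\<^sub>R C.skew e1 e2 x + anchor_deriv e1 f x *\<^sub>R e2 x
          - (1/2 * pairing e1 e2 x) *\<^sub>R \<D> f x)"
      if e: "e1 \<in> sections" "e2 \<in> sections" "f \<in> Cinf" for e1 e2 f
    proof -
      have pair: "pairing e1 (\<lambda>x. f x *\<^sub>R e2 x) = (\<lambda>x. f x * pairing e1 e2 x)"
        using e by (simp add: fun_eq_iff pairing_smult_right)
      show ?thesis
        by (rule ext) (use e in \<open>simp add: C.skew_eq pair opr_leibniz D_mult algebra_simps\<close>)
    qed
    show "anchor (\<D> f) = (\<lambda>x h. 0)" if "f \<in> Cinf" for f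
      using C.anchor_D_eq_zero[OF that] by (simp add: fun_eq_iff)
    show "anchor_deriv e (pairing h1 h2) =
        (\<lambda>x. pairing (\<lambda>y. C.skew e h1 y + (1/2) *\<^sub>R \<D> (pairing e h1) y) h2 x
           + pairing h1 (\<lambda>y. C.skew e h2 y + (1/2) *\<^sub>R \<D> (pairing e h2) y) x)"
      if "e \<in> sections" "h1 \<in> sections" "h2 \<in> sections" for e h1 h2
      using opr_metric[OF that] that by (simp only: C.opr_eq_skew)
  qed
  then show ?thesis
    by (simp add: C.skew_def[abs_def])
qed

theorem proposition2p6p5:
  fixes atlas :: "('m::{t2_space,second_countable_topology} set \<times> ('m \<Rightarrow> 'b::real_inner)) set"
    and E :: "'m \<Rightarrow> 'v::real_vector set"
    and k :: nat
    and frames :: "('m set \<times> (nat \<Rightarrow> 'm \<Rightarrow> 'v)) set"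
    and g :: "'m \<Rightarrow> 'v \<Rightarrow> 'v \<Rightarrow> real"
    and \<rho> :: "'m \<Rightarrow> 'v \<Rightarrow> ('m \<Rightarrow> real) \<Rightarrow> real"
  assumes "anchored_metric_bundle atlas E k frames g \<rho>"
  shows "(\<forall>br. skew_courant_algebroid atlas E k frames g \<rho> br \<longrightarrow>
           leibniz_courant_algebroid atlas E k frames g \<rho>
             (\<lambda>e1 e2 x. br e1 e2 x + (1/2) *\<^sub>R
                anchored_metric_bundle.\<D> atlas E k frames g \<rho>
                  (anchored_metric_bundle.pairing g e1 e2) x)) \<and>
         (\<forall>opr. leibniz_courant_algebroid atlas E k frames g \<rho> opr \<longrightarrow>
           skew_courant_algebroid atlas E k frames g \<rho>
             (\<lambda>e1 e2 x. (1/2) *\<^sub>R (opr e1 e2 x - opr e2 e1 x)))"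
  using skew_courant_algebroid.leibniz_courant_algebroid_symmetrized
    leibniz_courant_algebroid.skew_courant_algebroid_skew by blast

end
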